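(* Every class of metrizable compacta (resp. metrizable continua) closed under continuous images with a common model is strongly Polishable (resp. compactifiable). In particular, the class of all Peano continua (the metrizable continuous images of $[0,1]$) and the class of all weakly chainable continua (the metrizable continuous images of the pseudoarc) are compactifiable.
   Context: A metrizable compactum is a compact metrizable space; a continuum is a connected compactum. Two classes $\mathcal{C},\mathcal{D}$ of topological spaces (not necessarily closed under homeomorphic copies) are equivalent, written $\mathcal{C}\cong\mathcal{D}$, if every space in $\mathcal{C}$ is homeomorphic to a space in $\mathcal{D}$ and vice versa. A family of subsets of a topological space is regarded as a class of topological spaces by giving each member the subspace topology. A class $\mathcal{C}$ is closed under continuous images if every metrizable compactum that is a continuous image of a member of $\mathcal{C}$ belongs to $\mathcal{C}$. A common model of $\mathcal{C}$ is a member of $\mathcal{C}$ that can be mapped continuously onto every member of $\mathcal{C}$. A class $\mathcal{C}$ is compactifiable if there is a continuous map $q\colon A\to B$ between metrizable compacta such that $\{q^{-1}(b): b\in B\}\cong\mathcal{C}$. It is strongly Polishable if there is a continuous map $q\colon A\to B$ between Polish spaces such that $q$ is a closed and open map, $|B\setminus q[A]|\le 1$, and $\{q^{-1}(b): b\in B\}\cong\mathcal{C}$. *)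

theory Defs
  imports "HOL-Analysis.Analysis"
begin

text \<open>
  A class of topological spaces is rendered as a set of topologies on subsets of a type.
  Since a continuous image of a space has at most the cardinality of that space, all continuous
  images of spaces carried by a type have homeomorphic copies carried by the same type, so that
  closure under continuous images may be stated inside that type. Every metrizable compactum
  and every Polish space has a homeomorphic copy carried by a subset of the reals (lemma
  \<open>real_copy\<close> below).
\<close>

definition metrizable_compactum :: "'a topology \<Rightarrow> bool"
  where "metrizable_compactum X \<longleftrightarrow> compact_space X \<and> metrizable_space X"

text \<open>The empty space counts as a (connected) continuum.\<close>

definition metrizable_continuum :: "'a topology \<Rightarrow> bool"
  where "metrizable_continuum X \<longleftrightarrow> metrizable_compactum X \<and> connected_space X"

definition Polish_topology :: "'a topology \<Rightarrow> bool"
  where "Polish_topology X \<longleftrightarrow> separable_space X \<and> completely_metrizable_space X"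

definition equivalent_classes :: "'a topology set \<Rightarrow> 'b topology set \<Rightarrow> bool"
    (infix \<open>\<cong>\<^sub>C\<close> 50)
  where "C \<cong>\<^sub>C D \<longleftrightarrow>
    (\<forall>X\<in>C. \<exists>Y\<in>D. X homeomorphic_space Y) \<and>
    (\<forall>Y\<in>D. \<exists>X\<in>C. Y homeomorphic_space X)"

definition maps_onto :: "'a topology \<Rightarrow> 'b topology \<Rightarrow> bool"
  where "maps_onto X Y \<longleftrightarrow> (\<exists>f. continuous_map X Y f \<and> f ` topspace X = topspace Y)"

definition closed_under_continuous_images :: "'a topology set \<Rightarrow> bool"
  where "closed_under_continuous_images C \<longleftrightarrow>
    (\<forall>X\<in>C. \<forall>Y. metrizable_compactum Y \<and> maps_onto X Y \<longrightarrow> Y \<in> C)"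

definition common_model :: "'a topology set \<Rightarrow> 'a topology \<Rightarrow> bool"
  where "common_model C M \<longleftrightarrow> M \<in> C \<and> (\<forall>X\<in>C. maps_onto M X)"

definition fibres :: "'a topology \<Rightarrow> 'b topology \<Rightarrow> ('a \<Rightarrow> 'b) \<Rightarrow> 'a topology set"
  where "fibres A B q = {subtopology A {x \<in> topspace A. q x = b} | b. b \<in> topspace B}"

text \<open>
  The carriers of \<open>A\<close> and \<open>B\<close> are subsets of the reals, but their topologies are arbitrary.
  This is no restriction, see \<open>compactifiableI\<close> and \<open>strongly_PolishableI\<close> below.
\<close>

definition compactifiable :: "'a topology set \<Rightarrow> bool"
  where "compactifiable C \<longleftrightarrow>
    (\<exists>(A :: real topology) (B :: real topology) q.
      metrizable_compactum A \<and> metrizable_compactum B \<and> continuous_map A B q \<and>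
      fibres A B q \<cong>\<^sub>C C)"

definition strongly_Polishable :: "'a topology set \<Rightarrow> bool"
  where "strongly_Polishable C \<longleftrightarrow>
    (\<exists>(A :: real topology) (B :: real topology) q.
      Polish_topology A \<and> Polish_topology B \<and> continuous_map A B q \<and>
      closed_map A B q \<and> open_map A B q \<and>
      finite (topspace B - q ` topspace A) \<and> card (topspace B - q ` topspace A) \<le> 1 \<and>
      fibres A B q \<cong>\<^sub>C C)"

definition peano_continua :: "'a topology set"
  where "peano_continua = {X. metrizable_space X \<and> maps_onto (top_of_set {0..1::real}) X}"

definition subcontinuum :: "'a topology \<Rightarrow> 'a set \<Rightarrow> bool"
  where "subcontinuum X K \<longleftrightarrow> K \<subseteq> topspace X \<and> metrizable_continuum (subtopology X K)"

definition indecomposable :: "'a topology \<Rightarrow> bool"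
  where "indecomposable X \<longleftrightarrow>
    \<not> (\<exists>K L. subcontinuum X K \<and> subcontinuum X L \<and>
         K \<noteq> topspace X \<and> L \<noteq> topspace X \<and> K \<union> L = topspace X)"

definition hereditarily_indecomposable :: "'a topology \<Rightarrow> bool"
  where "hereditarily_indecomposable X \<longleftrightarrow>
    (\<forall>K. subcontinuum X K \<longrightarrow> indecomposable (subtopology X K))"

definition open_chain :: "'a topology \<Rightarrow> 'a set list \<Rightarrow> bool"
  where "open_chain X Us \<longleftrightarrow>
    (\<forall>U \<in> set Us. openin X U) \<and>
    (\<forall>i < length Us. \<forall>j < length Us. Us ! i \<inter> Us ! j \<noteq> {} \<longleftrightarrow> i \<le> Suc j \<and> j \<le> Suc i)"

definition chainable :: "'a topology \<Rightarrow> bool"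
  where "chainable X \<longleftrightarrow>
    (\<forall>\<V>. (\<forall>V\<in>\<V>. openin X V) \<and> \<Union>\<V> = topspace X \<longrightarrow>
      (\<exists>Us. open_chain X Us \<and> \<Union>(set Us) = topspace X \<and> (\<forall>U \<in> set Us. \<exists>V\<in>\<V>. U \<subseteq> V)))"

text \<open>
  By a theorem of Bing, the pseudoarc is characterised up to homeomorphism as the nondegenerate
  hereditarily indecomposable chainable metrizable continuum.
\<close>

definition pseudoarc :: "'a topology \<Rightarrow> bool"
  where "pseudoarc P \<longleftrightarrow>
    metrizable_continuum P \<and> (\<exists>x\<in>topspace P. \<exists>y\<in>topspace P. x \<noteq> y) \<and>
    hereditarily_indecomposable P \<and> chainable P"

text \<open>The parameter \<open>P\<close> is any copy of the pseudoarc.\<close>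

definition weakly_chainable_continua :: "'b topology \<Rightarrow> 'a topology set"
  where "weakly_chainable_continua P = {X. metrizable_space X \<and> maps_onto P X}"


lemma lepoll_homeomorphic_copy:
  assumes "topspace X \<lesssim> (UNIV :: 'b set)"
  shows "\<exists>Y :: 'b topology. X homeomorphic_space Y"
proof -
  obtain f :: "'a \<Rightarrow> 'b" where f: "inj_on f (topspace X)"
    using assms by (auto simp: lepoll_def)
  define g where "g = inv_into (topspace X) f"
  define Y where "Y = pullback_topology (f ` topspace X) g X"
  have gf: "g (f x) = x" if "x \<in> topspace X" for x
    using f that by (simp add: g_def)
  have top: "topspace Y = f ` topspace X"
    using gf by (auto simp: Y_def topspace_pullback_topology)
  have "continuous_map Y X g"
    using gf by (auto simp: continuous_map_def top openin_pullback_topology Y_def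
        topspace_pullback_topology)
  moreover have "continuous_map X Y f"
  proof (clarsimp simp: continuous_map_def top)
    fix U assume "openin Y U"
    then obtain V where V: "openin X V" "U = g -` V \<inter> f ` topspace X"
      by (auto simp: Y_def openin_pullback_topology)
    have "f x \<in> U \<longleftrightarrow> x \<in> V" if "x \<in> topspace X" for x
      using gf[OF that] that by (simp add: V(2))
    then have "{x \<in> topspace X. f x \<in> U} = V"
      using openin_subset[OF V(1)] by blast
    with V show "openin X {x \<in> topspace X. f x \<in> U}" by simp
  qed
  ultimately have "homeomorphic_maps X Y f g"
    using gf top by (auto simp: homeomorphic_maps_def)
  then show ?thesis by (auto simp: homeomorphic_space_def)
qed

lemma metrizable_compactum_imp_separable:
  assumes "metrizable_compactum X"
  shows "separable_space X"
proof -
  obtain M d where M: "Metric_space M d" "X = Metric_space.mtopology M d"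
    using assms by (auto simp: metrizable_compactum_def metrizable_space_def)
  interpret Metric_space M d by fact
  have "mtotally_bounded M"
    using assms M by (metis compactin_imp_mtotally_bounded compact_space_def
        metrizable_compactum_def topspace_mtopology)
  then have "\<exists>K. finite K \<and> K \<subseteq> M \<and> M \<subseteq> (\<Union>x\<in>K. mball x (inverse (Suc n)))" for n :: nat
    by (simp add: mtotally_bounded_def)
  then obtain K where K: "\<And>n::nat. finite (K n)" "\<And>n. K n \<subseteq> M"
    "\<And>n. M \<subseteq> (\<Union>x\<in>K n. mball x (inverse (Suc n)))"
    by metis
  define D where "D = (\<Union>n. K n)"
  have "\<exists>y\<in>D. y \<in> mball x r" if x: "x \<in> M" and r: "r > 0" for x r
  proof -
    obtain n where n: "inverse (real (Suc n)) < r"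
      using reals_Archimedean r by blast
    obtain y where "y \<in> K n" "x \<in> mball y (inverse (Suc n))"
      using K(3)[of n] x by blast
    with n show ?thesis by (auto simp: D_def commute intro!: bexI[of _ y])
  qed
  then have "mtopology closure_of D = M"
    by (fastforce simp: metric_closure_of)
  moreover have "countable D" "D \<subseteq> M"
    using K by (auto simp: D_def countable_finite)
  ultimately show ?thesis
    using M(2) by (auto simp: separable_space_def)
qed

lemma real_copy:
  assumes "separable_space X" "metrizable_space X"
  shows "\<exists>Y :: real topology. X homeomorphic_space Y"
proof (rule lepoll_homeomorphic_copy)
  obtain M d where M: "Metric_space M d" "X = Metric_space.mtopology M d"
    using assms by (auto simp: metrizable_space_def)
  interpret Metric_space M d by fact
  obtain D where D: "countable D" "D \<subseteq> M" "mtopology closure_of D = M"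
    using assms(1) M(2) by (auto simp: separable_space_def)
  define \<phi> where "\<phi> x = to_nat_on (D \<times> (UNIV::nat set)) `
      {(y, n). y \<in> D \<and> d y x < inverse (Suc n)}" for x
  have "inj_on \<phi> M"
  proof (rule inj_onI, rule ccontr)
    fix x y assume xy: "x \<in> M" "y \<in> M" "\<phi> x = \<phi> y" "x \<noteq> y"
    have cnt: "inj_on (to_nat_on (D \<times> (UNIV::nat set))) (D \<times> UNIV)"
      using D(1) by (simp add: inj_on_to_nat_on)
    have eq: "{(z, n). z \<in> D \<and> d z x < inverse (Suc n)} = {(z, n::nat). z \<in> D \<and> d z y < inverse (Suc n)}"
      using inj_on_image_eq_iff[OF cnt] xy(3) unfolding \<phi>_def
      by (smt (verit, best) SigmaI UNIV_I case_prod_conv mem_Collect_eq subset_iff surj_pair)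
    obtain n where n: "inverse (real (Suc n)) < d x y / 2"
      using reals_Archimedean[of "d x y / 2"] xy by auto
    have "0 < inverse (real (Suc n))" by simp
    then obtain z where z: "z \<in> D" "z \<in> mball x (inverse (Suc n))"
      using D(3) xy(1) unfolding metric_closure_of by blast
    then have "d z x < inverse (Suc n)" by (simp add: commute)
    moreover from this have "d z y < inverse (Suc n)"
      using eq z(1) by blast
    moreover have "d x y \<le> d z x + d z y"
      using triangle[of x z y] xy z D(2) by (auto simp: commute)
    ultimately show False using n by simp
  qed
  then have "topspace X \<lesssim> (UNIV :: nat set set)"
    using M(2) by (auto simp: lepoll_def)
  then show "topspace X \<lesssim> (UNIV :: real set)"
    using nat_sets_eqpoll_reals lepoll_trans2 by blast
qed

lemma fibres_homeomorphic_copy: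
  fixes A :: "'b topology" and B :: "'c topology" and A' :: "'d topology" and B' :: "'e topology"
  assumes q: "continuous_map A B q"
    and A: "homeomorphic_maps A A' f f'" and B: "homeomorphic_maps B B' g g'"
  shows "fibres A' B' (g \<circ> q \<circ> f') \<cong>\<^sub>C fibres A B q"
proof -
  have gB: "g ` topspace B = topspace B'"
    using B homeomorphic_imp_surjective_map homeomorphic_map_maps by blast
  have *: "subtopology A {x \<in> topspace A. q x = b} homeomorphic_space
       subtopology A' {x \<in> topspace A'. (g \<circ> q \<circ> f') x = g b}" if b: "b \<in> topspace B" for b
  proof -
    have f: "homeomorphic_map A A' f" using A homeomorphic_map_maps by blast
    have qB: "q x \<in> topspace B" if "x \<in> topspace A" for x
      using q that by (auto simp: continuous_map_def)
    have inj: "g u = g v \<longleftrightarrow> u = v" if "u \<in> topspace B" "v \<in> topspace B" for u v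
      using B that by (metis homeomorphic_maps_def)
    have ff: "f' (f x) = x" "f x \<in> topspace A'" if "x \<in> topspace A" for x
      using A that by (auto simp: homeomorphic_maps_def continuous_map_def)
    have ff': "f (f' x) = x" "f' x \<in> topspace A" if "x \<in> topspace A'" for x
      using A that by (auto simp: homeomorphic_maps_def continuous_map_def)
    have "f ` {x \<in> topspace A. q x = b} = {x \<in> topspace A'. (g \<circ> q \<circ> f') x = g b}"
    proof (intro equalityI subsetI)
      fix y assume "y \<in> {x \<in> topspace A'. (g \<circ> q \<circ> f') x = g b}"
      then show "y \<in> f ` {x \<in> topspace A. q x = b}"
        using ff' inj qB b by (intro image_eqI[of _ _ "f' y"]) auto
    qed (use ff in auto)
    then have "homeomorphic_map (subtopology A {x \<in> topspace A. q x = b})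
       (subtopology A' {x \<in> topspace A'. (g \<circ> q \<circ> f') x = g b}) f"
      using f ff by (intro homeomorphic_map_subtopologies) auto
    then show ?thesis using homeomorphic_map_imp_homeomorphic_space by blast
  qed
  define F where "F b = subtopology A {x \<in> topspace A. q x = b}" for b
  define F' where "F' b = subtopology A' {x \<in> topspace A'. (g \<circ> q \<circ> f') x = b}" for b
  have F: "fibres A B q = F ` topspace B" "fibres A' B' (g \<circ> q \<circ> f') = (\<lambda>b. F' (g b)) ` topspace B"
    unfolding fibres_def gB[symmetric] F_def F'_def by blast+
  have "F b homeomorphic_space F' (g b)" if "b \<in> topspace B" for b
    using *[OF that] by (simp only: F_def F'_def)
  then show ?thesis
    unfolding equivalent_classes_def F using homeomorphic_space_sym by blast
qed

lemma equivalent_classes_trans: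
  assumes "C \<cong>\<^sub>C D" "D \<cong>\<^sub>C E"
  shows "C \<cong>\<^sub>C E"
  using assms unfolding equivalent_classes_def by (meson homeomorphic_space_trans)

proposition compactifiableI:
  fixes A :: "'b topology" and B :: "'c topology"
  assumes A: "metrizable_compactum A" and B: "metrizable_compactum B"
    and q: "continuous_map A B q" and C: "fibres A B q \<cong>\<^sub>C C"
  shows "compactifiable C"
proof -
  obtain A' :: "real topology" and f f' where A': "homeomorphic_maps A A' f f'"
    using real_copy[of A] metrizable_compactum_imp_separable A
    unfolding homeomorphic_space_def metrizable_compactum_def by blast
  obtain B' :: "real topology" and g g' where B': "homeomorphic_maps B B' g g'"
    using real_copy[of B] metrizable_compactum_imp_separable B
    unfolding homeomorphic_space_def metrizable_compactum_def by blast
  have "continuous_map A' B' (g \<circ> q \<circ> f')"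
    using A' B' q by (meson continuous_map_compose homeomorphic_maps_def)
  moreover have "metrizable_compactum A'" "metrizable_compactum B'"
    using A B A' B' homeomorphic_metrizable_space homeomorphic_compact_space
    unfolding metrizable_compactum_def homeomorphic_space_def by metis+
  ultimately show ?thesis
    unfolding compactifiable_def
    using fibres_homeomorphic_copy[OF q A' B'] C equivalent_classes_trans by blast
qed

proposition strongly_PolishableI:
  fixes A :: "'b topology" and B :: "'c topology"
  assumes A: "Polish_topology A" and B: "Polish_topology B"
    and q: "continuous_map A B q" "closed_map A B q" "open_map A B q"
    and card: "finite (topspace B - q ` topspace A)" "card (topspace B - q ` topspace A) \<le> 1"
    and C: "fibres A B q \<cong>\<^sub>C C"
  shows "strongly_Polishable C"
proof -
  obtain A' :: "real topology" and f f' where A': "homeomorphic_maps A A' f f'"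
    using real_copy[of A] A completely_metrizable_imp_metrizable_space
    unfolding homeomorphic_space_def Polish_topology_def by blast
  obtain B' :: "real topology" and g g' where B': "homeomorphic_maps B B' g g'"
    using real_copy[of B] B completely_metrizable_imp_metrizable_space
    unfolding homeomorphic_space_def Polish_topology_def by blast
  have hf': "homeomorphic_map A' A f'" and hg: "homeomorphic_map B B' g"
    using A' B' homeomorphic_map_maps homeomorphic_maps_sym by blast+
  have "continuous_map A' B' (g \<circ> q \<circ> f')"
    using A' B' q by (meson continuous_map_compose homeomorphic_maps_def)
  moreover have "closed_map A' B' (g \<circ> q \<circ> f')" "open_map A' B' (g \<circ> q \<circ> f')"
    using q hf' hg by (meson closed_map_compose open_map_compose
        homeomorphic_imp_closed_map homeomorphic_imp_open_map)+
  moreover have "Polish_topology A'" "Polish_topology B'"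
    using A B A' B' homeomorphic_completely_metrizable_space homeomorphic_separable_space
    unfolding Polish_topology_def homeomorphic_space_def by metis+
  moreover have sub: "topspace B' - (g \<circ> q \<circ> f') ` topspace A' \<subseteq> g ` (topspace B - q ` topspace A)"
  proof -
    have fA: "f' ` topspace A' = topspace A" and gB: "g ` topspace B = topspace B'"
      using hf' hg homeomorphic_imp_surjective_map by blast+
    have "(g \<circ> q \<circ> f') ` topspace A' = g ` q ` topspace A"
      by (simp only: image_comp[symmetric] fA)
    then show ?thesis unfolding gB[symmetric] by blast
  qed
  moreover have "finite (topspace B' - (g \<circ> q \<circ> f') ` topspace A')"
    "card (topspace B' - (g \<circ> q \<circ> f') ` topspace A') \<le> 1"
    using finite_surj[OF card(1) sub] le_trans[OF surj_card_le[OF card(1) sub] card(2)] by blast+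
  ultimately show ?thesis
    unfolding strongly_Polishable_def
    using equivalent_classes_trans[OF fibres_homeomorphic_copy[OF q(1) A' B'] C] by blast
qed

end

theory Submission
  imports Defs
begin

text \<open>
  Let \<open>M\<close> be a common model of a class closed under continuous images. Embed \<open>M\<close> as a compact subset
  \<open>K\<close> of the Hilbert cube \<open>Q\<close>. Up to equivalence the class consists of the images \<open>f ` K\<close> of the continuous
  maps \<open>f\<close> from \<open>K\<close> to \<open>Q\<close> (\<open>closed_class_equivalent_image_compacta\<close>), so these images have to be
  arranged as the fibres of one map.

  A map \<open>f\<close> is coded by its values \<open>u i = f (m i)\<close> on a dense sequence \<open>m\<close> together with a modulus of
  continuity: numbers \<open>z k > 0\<close> such that points \<open>m i\<close>, \<open>m j\<close> at distance less than \<open>z k\<close> have values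
  that differ by at most \<open>(1/2) ^ k\<close> in the coordinates up to \<open>k\<close>. All codes \<open>(z, u)\<close> form a Polish space,
  and \<open>f ` K\<close>, which is the closure of the set of all \<open>u i\<close>, depends continuously on the code. This yields a
  closed and open projection of Polish spaces (\<open>image_compacta_strongly_Polishable\<close>).

  For continua the space of codes has to be compactified without adding fibres outside the class.
  Numbers \<open>z k = 0\<close> are admitted, with no condition at the scale \<open>k\<close>, and two devices keep the fibres
  under control. First, the image is enclosed at each scale \<open>k\<close> in a finite union of cubes, namely
  the cells of radius \<open>2 * (1/2) ^ k\<close> around those \<open>u i\<close> for which the \<open>m i\<close> form a suitable finite net;
  these enclosures vary upper semicontinuously as long as \<open>z k\<close> stays away from 0. Secondly, the
  coordinate \<open>j\<close> is multiplied by \<open>z 0 * \<dots> * z j\<close>. If no \<open>z k\<close> vanishes, this does not change the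
  homeomorphism type of the fibre. If \<open>k\<close> is the first scale with \<open>z k = 0\<close>, the rescaling kills
  all coordinates from \<open>k\<close> on, and the fibre becomes the rescaled enclosure of scale \<open>k - 1\<close>, or a point if
  \<open>k = 0\<close>. Since \<open>K\<close> is connected, the cubes of the enclosure are linked, so their union is the
  image of a curve (\<open>irregular_fibre\<close>, based on a space-filling curve in \<open>Q\<close>). A nondegenerate continuum
  \<open>K\<close> maps onto the unit interval, and so onto every such union. Hence all added fibres are again
  images of \<open>K\<close> (\<open>image_compacta_compactifiable\<close>).

  Peano continua and weakly chainable continua are the images of one fixed continuum
  (\<open>continuous_images_compactifiable\<close>).
\<close>

section \<open>Metrizable compacta in the Hilbert cube\<close>

definition hilbert_cube :: "(nat \<Rightarrow> real) set"
  where "hilbert_cube = {x. \<forall>i. x i \<in> {0..1}}"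

lemma compact_pointwise:
  fixes S :: "'i \<Rightarrow> 'b::topological_space set"
  assumes "\<And>i. compact (S i)"
  shows "compact {x. \<forall>i. x i \<in> S i}"
proof -
  have "{x. \<forall>i. x i \<in> S i} = PiE UNIV S"
    by auto
  then show ?thesis
    using assms compactin_PiE[of "\<lambda>_. euclidean :: 'b topology" UNIV S]
    by (simp add: euclidean_product_topology)
qed

lemma compact_hilbert_cube: "compact hilbert_cube"
  unfolding hilbert_cube_def by (rule compact_pointwise) simp

lemma metrizable_compactum_top_of_set:
  fixes K :: "'b::metric_space set"
  shows "compact K \<Longrightarrow> metrizable_compactum (top_of_set K)"
  by (simp add: metrizable_compactum_def compact_space_subtopology metrizable_space_subtopology
      metrizable_space_euclidean)

lemma homeomorphic_top_of_set_image:
  fixes f :: "'b::topological_space \<Rightarrow> 'c::metric_space"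
  assumes "compact K" "continuous_on K f" "inj_on f K"
  shows "top_of_set K homeomorphic_space top_of_set (f ` K)"
proof -
  have "homeomorphic_map (top_of_set K) (top_of_set (f ` K)) f"
    using assms
    by (intro continuous_imp_homeomorphic_map)
       (auto simp: compact_space_subtopology intro!: Hausdorff_space_subtopology)
  then show ?thesis
    by (rule homeomorphic_map_imp_homeomorphic_space)
qed

text \<open>The coordinates are the distances, cut off at 1, to the members of a dense sequence. They
  separate points, and an injective continuous map from a compact space into a metric space is an
  embedding.\<close>
lemma metrizable_compactum_hilbert_cube_copy:
  assumes "metrizable_compactum X"
  shows "\<exists>K\<subseteq>hilbert_cube. compact K \<and> X homeomorphic_space top_of_set K"
proof (cases "topspace X = {}")
  case True
  then show ?thesis
    by (intro exI[of _ "{}"]) (simp add: homeomorphic_empty_space_eq)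
next
  case False
  obtain M d where M: "Metric_space M d" "X = Metric_space.mtopology M d"
    using assms by (auto simp: metrizable_compactum_def metrizable_space_def)
  interpret Metric_space M d by fact
  obtain D where D: "countable D" "D \<subseteq> M" "mtopology closure_of D = M"
    using metrizable_compactum_imp_separable[OF assms] M(2) by (auto simp: separable_space_def)
  have ne: "M \<noteq> {}" "D \<noteq> {}"
    using False D(3) M(2) by auto
  define m where "m = from_nat_into D"
  have m: "range m = D"
    unfolding m_def using ne D(1) by (intro range_from_nat_into)
  have mM: "m i \<in> M" for i
    using m D(2) by auto
  have dense: "\<exists>i. d x (m i) < r" if x: "x \<in> M" and r: "r > 0" for x r
  proof -
    have "x \<in> {x \<in> M. \<forall>r>0. \<exists>y\<in>D. y \<in> mball x r}"
      using D(3) x by (simp only: metric_closure_of)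
    then obtain y where "y \<in> D" "d x y < r"
      using r by auto
    then show ?thesis using m by blast
  qed
  define e where "e x i = min 1 (d x (m i))" for x i
  have "continuous_map X euclideanreal (\<lambda>x. d x (m i))" for i
    using continuous_on_mdist[of "m i" Self] mM[of i] M(2)
    by (simp add: commute[of _ "m i"] mtopology_of_def)
  then have "continuous_map X euclideanreal (\<lambda>x. e x i)" for i
    unfolding e_def by (intro continuous_map_real_min) auto
  then have "continuous_map X euclidean e"
    unfolding euclidean_product_topology[symmetric] by (auto intro!: continuous_map_coordinatewise_then_product)
  then have cont: "continuous_map X (top_of_set (e ` M)) e"
    using M(2) by (simp add: continuous_map_in_subtopology)
  have inj: "inj_on e M"
  proof (rule inj_onI, rule ccontr)
    fix x y assume xy: "x \<in> M" "y \<in> M" "e x = e y" "x \<noteq> y"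
    define r where "r = min 1 (d x y) / 2"
    have r: "0 < r" "r < 1" "2 * r \<le> d x y"
      using xy by (auto simp: r_def)
    obtain i where i: "d x (m i) < r"
      using dense xy r by blast
    then have "d y (m i) < r"
      using fun_cong[OF xy(3), of i] r by (auto simp: e_def min_def split: if_splits)
    then show False
      using triangle[of x "m i" y] xy mM[of i] i r by (simp add: commute)
  qed
  have X: "compact_space X"
    using assms by (simp add: metrizable_compactum_def)
  have "homeomorphic_map X (top_of_set (e ` M)) e"
    using cont X inj M(2)
    by (intro continuous_imp_homeomorphic_map) (auto intro: Hausdorff_space_subtopology)
  then have hom: "X homeomorphic_space top_of_set (e ` M)"
    by (rule homeomorphic_map_imp_homeomorphic_space)
  then have "compact (e ` M)"
    using X homeomorphic_compact_space by (metis compact_space_subtopology compactin_euclidean_iff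
        compact_space_def compactin_subtopology topspace_euclidean_subtopology)
  moreover have "e ` M \<subseteq> hilbert_cube"
    by (auto simp: hilbert_cube_def e_def)
  ultimately show ?thesis using hom by blast
qed

lemma maps_onto_compose: "maps_onto X Y \<Longrightarrow> maps_onto Y Z \<Longrightarrow> maps_onto X Z"
  unfolding maps_onto_def by (metis continuous_map_compose image_comp)

lemma homeomorphic_imp_maps_onto: "X homeomorphic_space Y \<Longrightarrow> maps_onto X Y"
  unfolding maps_onto_def homeomorphic_space
  by (meson homeomorphic_imp_continuous_map homeomorphic_imp_surjective_map)

lemma maps_onto_homeomorphic_cong:
  assumes "X homeomorphic_space X'" "Y homeomorphic_space Y'"
  shows "maps_onto X Y \<longleftrightarrow> maps_onto X' Y'"
  using assms homeomorphic_imp_maps_onto homeomorphic_space_sym maps_onto_compose by meson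

lemma maps_onto_top_of_set_iff:
  "maps_onto (top_of_set K) (top_of_set L) \<longleftrightarrow> (\<exists>f. continuous_on K f \<and> f ` K = L)"
  by (auto simp: maps_onto_def)

text \<open>Surjections do not increase cardinality.\<close>
lemma image_copy:
  fixes X :: "'a topology"
  assumes "maps_onto X Y"
  shows "\<exists>Z :: 'a topology. Y homeomorphic_space Z"
proof (rule lepoll_homeomorphic_copy)
  obtain f where "f ` topspace X = topspace Y"
    using assms by (auto simp: maps_onto_def)
  then have "topspace Y \<lesssim> topspace X"
    by (metis image_lepoll)
  then show "topspace Y \<lesssim> (UNIV :: 'a set)"
    using lepoll_trans subset_imp_lepoll by blast
qed

lemma homeomorphic_metrizable_compactum:
  "X homeomorphic_space Y \<Longrightarrow> metrizable_compactum X \<longleftrightarrow> metrizable_compactum Y"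
  by (simp add: metrizable_compactum_def homeomorphic_compact_space homeomorphic_metrizable_space)

definition image_compacta :: "'b::topological_space set \<Rightarrow> (nat \<Rightarrow> real) set set"
  where "image_compacta K = {f ` K | f. continuous_on K f \<and> f ` K \<subseteq> hilbert_cube}"

text \<open>This replaces an abstract class by a concrete family of subsets of the Hilbert cube. Only the copy
  \<open>K\<close> of the model enters, so the carrier type of the class is out of the way from here on.\<close>
lemma closed_class_equivalent_image_compacta:
  fixes C :: "'a topology set" and K :: "'b::metric_space set"
  assumes C: "\<And>X. X \<in> C \<Longrightarrow> metrizable_compactum X" "closed_under_continuous_images C"
    and M: "common_model C M" "M homeomorphic_space top_of_set K" "compact K"
  shows "top_of_set ` image_compacta K \<cong>\<^sub>C C"
  unfolding equivalent_classes_def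
proof (intro conjI ballI)
  fix Y assume "Y \<in> top_of_set ` image_compacta K"
  then obtain f where f: "continuous_on K f" "Y = top_of_set (f ` K)"
    by (auto simp: image_compacta_def)
  have KY: "maps_onto (top_of_set K) Y"
    using f by (auto simp: maps_onto_top_of_set_iff)
  have MY: "maps_onto M Y"
    using maps_onto_compose[OF homeomorphic_imp_maps_onto[OF M(2)] KY] .
  then obtain Z :: "'a topology" where Z: "Y homeomorphic_space Z"
    using image_copy by blast
  have "metrizable_compactum Y"
    using f M(3) by (simp add: metrizable_compactum_top_of_set compact_continuous_image)
  then have "metrizable_compactum Z"
    using Z homeomorphic_metrizable_compactum by blast
  moreover have "maps_onto M Z"
    using maps_onto_compose[OF MY homeomorphic_imp_maps_onto[OF Z]] .
  moreover have "M \<in> C"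
    using M(1) by (simp add: common_model_def)
  ultimately have "Z \<in> C"
    using C(2) unfolding closed_under_continuous_images_def by blast
  with Z show "\<exists>Z\<in>C. Y homeomorphic_space Z" by blast
next
  fix X assume X: "X \<in> C"
  obtain L where L: "L \<subseteq> hilbert_cube" "X homeomorphic_space top_of_set L"
    using metrizable_compactum_hilbert_cube_copy C(1) X by blast
  have "maps_onto M X"
    using M(1) X by (simp add: common_model_def)
  then have "maps_onto (top_of_set K) (top_of_set L)"
    using maps_onto_homeomorphic_cong[OF M(2) L(2)] by blast
  then have "L \<in> image_compacta K"
    using L(1) by (auto simp: maps_onto_top_of_set_iff image_compacta_def)
  with L show "\<exists>Y\<in>top_of_set ` image_compacta K. X homeomorphic_space Y" by blast
qed

section \<open>Nets\<close>

text \<open>The numbers \<open>\<tau> i\<close> organise one dense sequence into nets of all sizes at once: since \<open>\<tau>\<close> tends to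
  0, the points \<open>m i\<close> with \<open>\<zeta> \<le> \<tau> i\<close> form a finite \<open>\<zeta>/2\<close>-net. That the net is cut out by the
  weak inequality \<open>\<zeta> \<le> \<tau> i\<close> makes it depend upper semicontinuously on \<open>\<zeta>\<close>. The witness for \<open>\<tau> i\<close>
  is the supremum of the \<open>\<zeta> \<le> 1\<close> for which the points before \<open>m i\<close> are no \<open>\<zeta>/2\<close>-net.\<close>
lemma compact_net_sequence:
  fixes K :: "'b::metric_space set"
  assumes K: "compact K" "K \<noteq> {}"
  obtains m :: "nat \<Rightarrow> 'b" and \<tau> :: "nat \<Rightarrow> real" where
    "range m \<subseteq> K" "\<tau> \<longlonglongrightarrow> 0"
    "\<And>\<zeta> y. 0 < \<zeta> \<Longrightarrow> \<zeta> \<le> 1 \<Longrightarrow> y \<in> K \<Longrightarrow> \<exists>i. \<zeta> \<le> \<tau> i \<and> dist y (m i) < \<zeta> / 2"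
proof -
  have sep: "separable_space (top_of_set K)"
    using metrizable_compactum_imp_separable metrizable_compactum_top_of_set K(1) by blast
  then obtain D where D: "countable D" "D \<subseteq> K" "top_of_set K closure_of D = K"
    by (auto simp: separable_space_def)
  have cl: "K \<subseteq> closure D"
    using D(2,3) by (auto simp: closure_of_subtopology inf.absorb2)
  have "D \<noteq> {}" using cl K(2) by auto
  define m where "m = from_nat_into D"
  have m: "range m = D"
    unfolding m_def using \<open>D \<noteq> {}\<close> D(1) by (intro range_from_nat_into)
  have dense: "\<exists>i. dist y (m i) < r" if "y \<in> K" "r > 0" for y r
  proof -
    have "y \<in> closure (range m)" using cl m that by auto
    then show ?thesis using that by (auto simp: closure_approachable dist_commute)
  qed
  define Z where "Z i = {\<zeta> \<in> {0..1}. \<zeta> = 0 \<or> (\<exists>y\<in>K. \<forall>j<i. \<zeta> / 2 \<le> dist y (m j))}" for i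
  define \<tau> where "\<tau> i = Sup (Z i)" for i
  have bdd: "bdd_above (Z i)" for i
    by (auto simp: Z_def bdd_above_def)
  have Z0: "0 \<in> Z i" for i
    by (auto simp: Z_def)
  show thesis
  proof
    show "range m \<subseteq> K" using m D(2) by simp
    show "\<exists>i. \<zeta> \<le> \<tau> i \<and> dist y (m i) < \<zeta> / 2" if \<zeta>: "0 < \<zeta>" "\<zeta> \<le> 1" "y \<in> K" for \<zeta> y
    proof -
      have ex: "\<exists>i. dist y (m i) < \<zeta> / 2" using \<zeta> by (intro dense) auto
      \<comment> \<open>The first net point near \<open>y\<close> comes at a stage when the preceding ones still miss \<open>y\<close>.\<close>
      define i where "i = (LEAST i. dist y (m i) < \<zeta> / 2)"
      have i: "dist y (m i) < \<zeta> / 2" "\<And>j. j < i \<Longrightarrow> \<zeta> / 2 \<le> dist y (m j)"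
        unfolding i_def using LeastI_ex[OF ex] not_less_Least by (auto simp: not_less[symmetric])
      then have "\<zeta> \<in> Z i" using \<zeta> by (auto simp: Z_def)
      then have "\<zeta> \<le> \<tau> i" unfolding \<tau>_def by (rule cSup_upper[OF _ bdd])
      with i show ?thesis by blast
    qed
    show "\<tau> \<longlonglongrightarrow> 0"
    proof (rule LIMSEQ_I)
      fix r :: real assume r: "r > 0"
      define \<epsilon> where "\<epsilon> = r / 2"
      have \<epsilon>: "\<epsilon> > 0" "\<epsilon> < r" using r by (auto simp: \<epsilon>_def)
      have "K \<subseteq> (\<Union>i. ball (m i) (\<epsilon> / 2))"
      proof
        fix y assume "y \<in> K"
        then obtain i where "dist y (m i) < \<epsilon> / 2"
          using dense[of y "\<epsilon> / 2"] \<epsilon> by auto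
        then show "y \<in> (\<Union>i. ball (m i) (\<epsilon> / 2))" by (auto simp: dist_commute)
      qed
      then obtain I where I: "I \<subseteq> UNIV" "finite I" "K \<subseteq> (\<Union>i\<in>I. ball (m i) (\<epsilon> / 2))"
        by (rule compactE_image[OF K(1) open_ball])
      have "\<exists>N. \<forall>i\<in>I. i < N"
        using I(2) by (rule finite_nat_set_iff_bounded[THEN iffD1])
      then obtain N where N: "\<And>i. i \<in> I \<Longrightarrow> i < N"
        by blast
      have "norm (\<tau> n - 0) < r" if n: "n \<ge> N" for n
      proof -
        have "\<zeta> \<le> \<epsilon>" if \<zeta>: "\<zeta> \<in> Z n" for \<zeta>
        proof (cases "\<zeta> = 0")
          case False
          with \<zeta> have "\<exists>y\<in>K. \<forall>j<n. \<zeta> / 2 \<le> dist y (m j)"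
            by (simp add: Z_def)
          then obtain y where y: "y \<in> K" "\<And>j. j < n \<Longrightarrow> \<zeta> / 2 \<le> dist y (m j)"
            by blast
          have "y \<in> (\<Union>i\<in>I. ball (m i) (\<epsilon> / 2))" using I(3) y(1) by blast
          then obtain i where i: "i \<in> I" "dist (m i) y < \<epsilon> / 2" by auto
          have "\<zeta> / 2 \<le> dist y (m i)"
            using N[OF i(1)] n by (intro y(2)) simp
          with i(2) show ?thesis
            by (simp add: dist_commute)
        qed (use \<epsilon> in auto)
        moreover have "Z n \<noteq> {}" using Z0[of n] by blast
        ultimately have "\<tau> n \<le> \<epsilon>"
          unfolding \<tau>_def by (intro cSup_least)
        moreover have "0 \<le> \<tau> n"
          unfolding \<tau>_def by (rule cSup_upper[OF Z0 bdd])
        ultimately show ?thesis using \<epsilon> by simp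
      qed
      then show "\<exists>N. \<forall>n\<ge>N. norm (\<tau> n - 0) < r" by blast
    qed
  qed
qed

section \<open>Coding maps by values on a net\<close>

lemma continuous_coordinates:
  "continuous_on UNIV (\<lambda>x :: nat \<Rightarrow> real. x i)"
  "continuous_on UNIV (\<lambda>b :: (nat \<Rightarrow> real) \<times> 'c::topological_space. fst b i)"
  "continuous_on UNIV (\<lambda>b :: 'c \<times> (nat \<Rightarrow> nat \<Rightarrow> real). snd b i j)"
  "continuous_on UNIV (\<lambda>p :: 'c \<times> (nat \<Rightarrow> real). snd p i)"
  "continuous_on UNIV (\<lambda>p :: ((nat \<Rightarrow> real) \<times> 'c) \<times> 'd::topological_space. fst (fst p) i)"
  "continuous_on UNIV (\<lambda>p :: ('c \<times> (nat \<Rightarrow> nat \<Rightarrow> real)) \<times> 'd. snd (fst p) i j)"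
proof -
  note coord = continuous_on_product_then_coordinatewise
  have id: "continuous_on UNIV (\<lambda>x :: nat \<Rightarrow> real. x)"
    by (rule continuous_on_id)
  have fst: "continuous_on UNIV (\<lambda>b :: (nat \<Rightarrow> real) \<times> 'c. fst b)"
    by (intro continuous_intros)
  have snd: "continuous_on UNIV (\<lambda>b :: 'c \<times> (nat \<Rightarrow> nat \<Rightarrow> real). snd b)"
    "continuous_on UNIV (\<lambda>b :: 'c \<times> (nat \<Rightarrow> real). snd b)"
    by (intro continuous_intros)+
  have comp: "continuous_on UNIV (\<lambda>p :: ((nat \<Rightarrow> real) \<times> 'c) \<times> 'd. fst (fst p))"
    "continuous_on UNIV (\<lambda>p :: ('c \<times> (nat \<Rightarrow> nat \<Rightarrow> real)) \<times> 'd. snd (fst p))"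
    by (intro continuous_intros)+
  show "continuous_on UNIV (\<lambda>x :: nat \<Rightarrow> real. x i)"
    by (rule coord[OF id])
  show "continuous_on UNIV (\<lambda>b :: (nat \<Rightarrow> real) \<times> 'c. fst b i)"
    by (rule coord[OF fst])
  show "continuous_on UNIV (\<lambda>b :: 'c \<times> (nat \<Rightarrow> nat \<Rightarrow> real). snd b i j)"
    by (rule coord[OF coord[OF snd(1)]])
  show "continuous_on UNIV (\<lambda>p :: 'c \<times> (nat \<Rightarrow> real). snd p i)"
    by (rule coord[OF snd(2)])
  show "continuous_on UNIV (\<lambda>p :: ((nat \<Rightarrow> real) \<times> 'c) \<times> 'd. fst (fst p) i)"
    by (rule coord[OF comp(1)])
  show "continuous_on UNIV (\<lambda>p :: ('c \<times> (nat \<Rightarrow> nat \<Rightarrow> real)) \<times> 'd. snd (fst p) i j)"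
    by (rule coord[OF coord[OF comp(2)]])
qed

locale net_sequence =
  fixes K :: "'b::metric_space set" and m :: "nat \<Rightarrow> 'b" and \<tau> :: "nat \<Rightarrow> real"
  assumes compact_K: "compact K"
    and m_in: "range m \<subseteq> K"
    and \<tau>_lim: "\<tau> \<longlonglongrightarrow> 0"
    and net: "\<And>\<zeta> y. 0 < \<zeta> \<Longrightarrow> \<zeta> \<le> 1 \<Longrightarrow> y \<in> K \<Longrightarrow> \<exists>i. \<zeta> \<le> \<tau> i \<and> dist y (m i) < \<zeta> / 2"
begin

text \<open>A code \<open>(z, u)\<close> describes a map by its values \<open>u i\<close> at \<open>m i\<close> together with a modulus of continuity
  \<open>z\<close>. In the product topology continuity is a matter of finitely many coordinates at a time, so
  scale \<open>k\<close> controls the coordinates up to \<open>k\<close> only. The value \<open>z k = 0\<close>, for which the condition at scale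
  \<open>k\<close> is void, makes the set of codes compact; a code with such a zero need not describe a
  map.\<close>
definition codes :: "((nat \<Rightarrow> real) \<times> (nat \<Rightarrow> nat \<Rightarrow> real)) set"
  where "codes = {(z, u). z \<in> hilbert_cube \<and> (\<forall>i. u i \<in> hilbert_cube) \<and>
    (\<forall>k i j. z k \<le> dist (m i) (m j) \<or> (\<forall>l\<le>k. \<bar>u i l - u j l\<bar> \<le> (1/2) ^ k))}"

text \<open>The radius is twice the accuracy \<open>(1/2) ^ k\<close> of scale \<open>k\<close>, so that a cell of scale \<open>k + 1\<close>
  around a value lies in a cell of scale \<open>k\<close> around a value on the net of that scale
  (\<open>stage_Suc_subset\<close>).\<close>
definition cell :: "nat \<Rightarrow> (nat \<Rightarrow> real) \<Rightarrow> (nat \<Rightarrow> real) set"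
  where "cell k c = {x \<in> hilbert_cube. \<forall>l\<le>k. \<bar>x l - c l\<bar> \<le> 2 * (1/2) ^ k}"

text \<open>The union of the cells around the values on a finite \<open>\<zeta>/2\<close>-net is the outer approximation of
  the image that can be read off from a code at scale \<open>k\<close>.\<close>
definition stage :: "nat \<Rightarrow> real \<Rightarrow> (nat \<Rightarrow> nat \<Rightarrow> real) \<Rightarrow> (nat \<Rightarrow> real) set"
  where "stage k \<zeta> u = (\<Union>i\<in>{i. \<zeta> \<le> \<tau> i}. cell k (u i))"

text \<open>The approximation at scale \<open>k\<close> is imposed only if no zero occurs up to \<open>k\<close>. This proviso
  is a closed condition, as is needed for compactness.\<close>
definition total_space :: "(((nat \<Rightarrow> real) \<times> (nat \<Rightarrow> nat \<Rightarrow> real)) \<times> (nat \<Rightarrow> real)) set"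
  where "total_space = {((z, u), x). (z, u) \<in> codes \<and> x \<in> hilbert_cube \<and>
    (\<forall>k. (\<exists>i\<le>k. z i = 0) \<or> x \<in> stage k (z k) u)}"

lemma finite_net: "0 < \<zeta> \<Longrightarrow> finite {i. \<zeta> \<le> \<tau> i}"
proof -
  assume "0 < \<zeta>"
  then obtain N where "\<And>i. i \<ge> N \<Longrightarrow> \<bar>\<tau> i\<bar> < \<zeta>"
    using LIMSEQ_D[OF \<tau>_lim] by fastforce
  then have "{i. \<zeta> \<le> \<tau> i} \<subseteq> {..<N}"
    by (force simp: not_le[symmetric])
  then show ?thesis using finite_subset by blast
qed

lemma compact_codes: "compact codes"
proof -
  have "closed {b :: (nat \<Rightarrow> real) \<times> (nat \<Rightarrow> nat \<Rightarrow> real).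
      \<forall>k i j. fst b k \<le> dist (m i) (m j) \<or> (\<forall>l\<le>k. \<bar>snd b i l - snd b j l\<bar> \<le> (1/2) ^ k)}"
    by (intro closed_Collect_all closed_Collect_disj closed_Collect_imp open_Collect_const
        closed_Collect_le continuous_coordinates continuous_on_diff continuous_on_rabs continuous_on_const)
  moreover have "compact (hilbert_cube \<times> {u :: nat \<Rightarrow> nat \<Rightarrow> real. \<forall>i. u i \<in> hilbert_cube})"
    by (intro compact_Times compact_pointwise compact_hilbert_cube)
  moreover have "codes = (hilbert_cube \<times> {u. \<forall>i. u i \<in> hilbert_cube}) \<inter>
      {b. \<forall>k i j. fst b k \<le> dist (m i) (m j) \<or> (\<forall>l\<le>k. \<bar>snd b i l - snd b j l\<bar> \<le> (1/2) ^ k)}"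
    unfolding codes_def by (intro set_eqI) (simp add: split_beta mem_Times_iff conj_assoc)
  ultimately show ?thesis
    by (simp only: compact_Int_closed)
qed

lemma closed_stage_condition:
  "closed {p :: ((nat \<Rightarrow> real) \<times> (nat \<Rightarrow> nat \<Rightarrow> real)) \<times> (nat \<Rightarrow> real).
     (\<exists>i\<le>k. fst (fst p) i = 0) \<or>
     (fst (fst p) k \<le> 0 \<or> (\<exists>i. fst (fst p) k \<le> \<tau> i \<and> (\<forall>l\<le>k. \<bar>snd p l - snd (fst p) i l\<bar> \<le> 2 * (1/2) ^ k)))}"
proof -
  define P where "P i p \<longleftrightarrow> fst (fst p) k \<le> \<tau> i \<and>
      (\<forall>l\<le>k. \<bar>snd p l - snd (fst p) i l\<bar> \<le> 2 * (1/2) ^ k)"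
    for i and p :: "((nat \<Rightarrow> real) \<times> (nat \<Rightarrow> nat \<Rightarrow> real)) \<times> (nat \<Rightarrow> real)"
  have P: "closed {p. P i p}" for i
    unfolding P_def
    by (intro closed_Collect_conj closed_Collect_all closed_Collect_imp open_Collect_const
        closed_Collect_le continuous_coordinates continuous_on_diff continuous_on_rabs continuous_on_const)
  have "closed (\<Inter>r\<in>{0<..}. {p. fst (fst p) k \<le> r} \<union> (\<Union>i\<in>{i. r \<le> \<tau> i}. {p. P i p}))"
    using finite_net
    by (intro closed_INT ballI closed_Un closed_UN closed_Collect_le continuous_coordinates continuous_on_diff continuous_on_rabs continuous_on_const P) auto
  \<comment> \<open>Away from \<open>z\<^sub>k = 0\<close> only finitely many cells matter, so their union is closed there.\<close>
  also have "(\<Inter>r\<in>{0<..}. {p. fst (fst p) k \<le> r} \<union> (\<Union>i\<in>{i. r \<le> \<tau> i}. {p. P i p}))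
      = {p. fst (fst p) k \<le> 0 \<or> (\<exists>i. P i p)}" (is "?L = ?R")
  proof (intro equalityI subsetI)
    fix p assume p: "p \<in> ?L"
    show "p \<in> ?R"
    proof (cases "fst (fst p) k \<le> 0")
      case False
      have "fst (fst p) k \<le> r \<or> (\<exists>i. r \<le> \<tau> i \<and> P i p)" if "0 < r" for r
        using p that by auto
      from this[of "fst (fst p) k / 2"] False show ?thesis by auto
    qed simp
  next
    fix p assume p: "p \<in> ?R"
    show "p \<in> ?L"
    proof (intro INT_I)
      fix r :: real assume r: "r \<in> {0<..}"
      show "p \<in> {p. fst (fst p) k \<le> r} \<union> (\<Union>i\<in>{i. r \<le> \<tau> i}. {p. P i p})"
        using p r by (force simp: P_def)
    qed
  qed
  finally have "closed {p. fst (fst p) k \<le> 0 \<or> (\<exists>i. P i p)}" .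
  moreover have "closed (\<Union>i\<le>k. {p :: ((nat \<Rightarrow> real) \<times> (nat \<Rightarrow> nat \<Rightarrow> real)) \<times> (nat \<Rightarrow> real). fst (fst p) i = 0})"
    by (intro closed_UN ballI finite_atMost closed_Collect_eq continuous_coordinates continuous_on_diff continuous_on_rabs continuous_on_const)
  ultimately have "closed ((\<Union>i\<le>k. {p. fst (fst p) i = 0}) \<union> {p. fst (fst p) k \<le> 0 \<or> (\<exists>i. P i p)})"
    by blast
  then show ?thesis
    unfolding P_def by (rule back_subst[where P = closed]) auto
qed

lemma compact_total_space: "compact total_space"
proof -
  have nonneg: "z \<in> hilbert_cube \<Longrightarrow> z k \<le> 0 \<longleftrightarrow> z k = 0" for z :: "nat \<Rightarrow> real" and k
    by (auto simp: hilbert_cube_def intro: antisym)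
  have "total_space = (codes \<times> hilbert_cube) \<inter> {p. \<forall>k. (\<exists>i\<le>k. fst (fst p) i = 0) \<or>
     (fst (fst p) k \<le> 0 \<or> (\<exists>i. fst (fst p) k \<le> \<tau> i \<and> (\<forall>l\<le>k. \<bar>snd p l - snd (fst p) i l\<bar> \<le> 2 * (1/2) ^ k)))}"
    (is "_ = _ \<inter> {p. \<forall>k. ?Q k p}")
  proof (intro set_eqI)
    fix p :: "((nat \<Rightarrow> real) \<times> (nat \<Rightarrow> nat \<Rightarrow> real)) \<times> (nat \<Rightarrow> real)"
    obtain z u x where p: "p = ((z, u), x)" by (metis surj_pair)
    have "(\<exists>i\<le>k. z i = 0) \<or> x \<in> stage k (z k) u \<longleftrightarrow> ?Q k p"
      if zu: "(z, u) \<in> codes" and x: "x \<in> hilbert_cube" for k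
    proof -
      have "z k \<le> 0 \<longleftrightarrow> z k = 0"
        using zu by (intro nonneg) (simp add: codes_def)
      then show ?thesis
        using x by (auto simp: p stage_def cell_def)
    qed
    then show "p \<in> total_space \<longleftrightarrow> p \<in> (codes \<times> hilbert_cube) \<inter> {p. \<forall>k. ?Q k p}"
      unfolding p total_space_def by blast
  qed
  moreover have "compact (codes \<times> hilbert_cube)"
    by (intro compact_Times compact_codes compact_hilbert_cube)
  moreover have "closed {p. \<forall>k. ?Q k p}"
    by (intro closed_Collect_all closed_stage_condition)
  ultimately show ?thesis
    by (simp only: compact_Int_closed)
qed

lemma code_cube: "(z, u) \<in> codes \<Longrightarrow> u i \<in> hilbert_cube" "(z, u) \<in> codes \<Longrightarrow> z \<in> hilbert_cube"
  by (auto simp: codes_def)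

lemma code_bounds: "(z, u) \<in> codes \<Longrightarrow> 0 \<le> z k \<and> z k \<le> 1"
  by (auto simp: codes_def hilbert_cube_def)

lemma code_modulus:
  assumes "(z, u) \<in> codes" "dist (m i) (m j) < z k" "l \<le> k"
  shows "\<bar>u i l - u j l\<bar> \<le> (1/2) ^ k"
proof -
  have "z k \<le> dist (m i) (m j) \<or> (\<forall>l\<le>k. \<bar>u i l - u j l\<bar> \<le> (1/2) ^ k)"
    using assms(1) unfolding codes_def by blast
  then show ?thesis using assms(2,3) by simp
qed

lemma code_net:
  assumes "(z, u) \<in> codes" "0 < z k"
  obtains i where "z k \<le> \<tau> i" "\<And>l. l \<le> k \<Longrightarrow> \<bar>u j l - u i l\<bar> \<le> (1/2) ^ k"
proof -
  obtain i where i: "z k \<le> \<tau> i" "dist (m j) (m i) < z k / 2"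
    using net[of "z k" "m j"] assms code_bounds m_in by blast
  have "dist (m j) (m i) < z k"
    using i(2) assms(2) by simp
  then have "\<bar>u j l - u i l\<bar> \<le> (1/2) ^ k" if "l \<le> k" for l
    using code_modulus[OF assms(1)] that by blast
  with i(1) show thesis by (rule that)
qed

lemma values_in_stage:
  assumes "(z, u) \<in> codes" "0 < z k"
  shows "u j \<in> stage k (z k) u"
proof -
  obtain i where i: "z k \<le> \<tau> i" "\<And>l. l \<le> k \<Longrightarrow> \<bar>u j l - u i l\<bar> \<le> (1/2) ^ k"
    using code_net[OF assms] by metis
  have "u j \<in> cell k (u i)"
    unfolding cell_def
  proof (intro CollectI conjI allI impI)
    fix l assume "l \<le> k"
    then have "\<bar>u j l - u i l\<bar> \<le> (1/2) ^ k" by (rule i(2))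
    also have "\<dots> \<le> 2 * (1/2) ^ k" by simp
    finally show "\<bar>u j l - u i l\<bar> \<le> 2 * (1/2) ^ k" .
  qed (rule code_cube[OF assms(1)])
  with i show ?thesis by (auto simp: stage_def)
qed

text \<open>A value at scale \<open>k + 1\<close> is within \<open>(1/2) ^ k\<close> of a value on the net of scale \<open>k\<close>, and the
  radii satisfy \<open>2 * (1/2) ^ (k + 1) + (1/2) ^ k = 2 * (1/2) ^ k\<close>.\<close>
lemma stage_Suc_subset:
  assumes "(z, u) \<in> codes" "0 < z k"
  shows "stage (Suc k) \<zeta> u \<subseteq> stage k (z k) u"
proof
  fix x assume "x \<in> stage (Suc k) \<zeta> u"
  then obtain j where j: "x \<in> hilbert_cube" "\<And>l. l \<le> Suc k \<Longrightarrow> \<bar>x l - u j l\<bar> \<le> 2 * (1/2) ^ Suc k"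
    by (auto simp: stage_def cell_def)
  obtain i where i: "z k \<le> \<tau> i" "\<And>l. l \<le> k \<Longrightarrow> \<bar>u j l - u i l\<bar> \<le> (1/2) ^ k"
    using code_net[OF assms] by metis
  have "\<bar>x l - u i l\<bar> \<le> 2 * (1/2) ^ k" if "l \<le> k" for l
    using j(2)[of l] i(2)[of l] that by simp
  with i(1) j(1) show "x \<in> stage k (z k) u"
    by (auto simp: stage_def cell_def)
qed

lemma closed_cell: "closed (cell k c)"
proof -
  have "closed {x :: nat \<Rightarrow> real. \<forall>l\<le>k. \<bar>x l - c l\<bar> \<le> 2 * (1/2) ^ k}"
    by (intro closed_Collect_all closed_Collect_imp open_Collect_const closed_Collect_le
        continuous_coordinates continuous_on_diff continuous_on_rabs continuous_on_const)
  moreover have "cell k c = hilbert_cube \<inter> {x. \<forall>l\<le>k. \<bar>x l - c l\<bar> \<le> 2 * (1/2) ^ k}"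
    by (auto simp: cell_def)
  ultimately show ?thesis
    using compact_imp_closed[OF compact_hilbert_cube] by (simp add: closed_Int)
qed

lemma closure_pointwise:
  fixes x :: "nat \<Rightarrow> real"
  assumes "\<And>k. \<exists>y\<in>S. \<forall>l\<le>k. \<bar>x l - y l\<bar> \<le> 2 * (1/2) ^ k"
  shows "x \<in> closure S"
proof -
  obtain y where y: "\<And>k. y k \<in> S" "\<And>k l. l \<le> k \<Longrightarrow> \<bar>x l - y k l\<bar> \<le> 2 * (1/2) ^ k"
    using assms by metis
  have "(\<lambda>k. y k l) \<longlonglongrightarrow> x l" for l
  proof (rule LIM_zero_cancel, rule Lim_null_comparison)
    have "\<forall>\<^sub>F k in sequentially. l \<le> k" by (rule eventually_ge_at_top)
    then show "\<forall>\<^sub>F k in sequentially. norm (y k l - x l) \<le> 2 * (1/2) ^ k"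
      by eventually_elim (use y(2) in \<open>simp add: abs_minus_commute\<close>)
    show "(\<lambda>k. 2 * (1/2::real) ^ k) \<longlonglongrightarrow> 0"
      by (intro tendsto_mult_right_zero LIMSEQ_power_zero) simp
  qed
  then have "y \<longlonglongrightarrow> x"
    unfolding limitin_canonical_iff[symmetric] euclidean_product_topology[symmetric]
      limitin_componentwise by simp
  then show ?thesis
    using y(1) closure_sequential by blast
qed

text \<open>All approximations are imposed here, and they shrink to the closure of the listed values, which by
  \<open>code_decode\<close> below is the image of the coded map.\<close>
lemma regular_fibre:
  assumes zu: "(z, u) \<in> codes" and pos: "\<And>k. 0 < z k"
  shows "{x. ((z, u), x) \<in> total_space} = closure (range u)"
proof -
  have eq: "{x. ((z, u), x) \<in> total_space} = hilbert_cube \<inter> (\<Inter>k. stage k (z k) u)"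
    using zu less_imp_neq[OF pos, symmetric] by (auto simp: total_space_def)
  have "closed (stage k (z k) u)" for k
    unfolding stage_def using finite_net[OF pos] closed_cell by (intro closed_UN) auto
  then have "closed {x. ((z, u), x) \<in> total_space}"
    unfolding eq using compact_imp_closed[OF compact_hilbert_cube] by blast
  moreover have "range u \<subseteq> {x. ((z, u), x) \<in> total_space}"
    unfolding eq using values_in_stage[OF zu pos] code_cube[OF zu] by blast
  moreover have "x \<in> closure (range u)" if x: "((z, u), x) \<in> total_space" for x
  proof (rule closure_pointwise)
    fix k
    have "x \<in> stage k (z k) u" using x eq by blast
    then show "\<exists>y\<in>range u. \<forall>l\<le>k. \<bar>x l - y l\<bar> \<le> 2 * (1/2) ^ k"
      by (auto simp: stage_def cell_def)
  qed
  ultimately show ?thesis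
    by (intro equalityI closure_minimal) auto
qed

lemma dense_m: "closure (range m) = K"
proof
  show "closure (range m) \<subseteq> K"
    using m_in compact_K by (simp add: closure_minimal compact_imp_closed)
  show "K \<subseteq> closure (range m)"
  proof
    fix y assume y: "y \<in> K"
    show "y \<in> closure (range m)"
      unfolding closure_approachable
    proof (intro allI impI)
      fix e :: real assume "0 < e"
      then obtain i where "dist y (m i) < min e 1 / 2"
        using net[of "min e 1" y] y by auto
      then show "\<exists>x\<in>range m. dist x y < e"
        using \<open>0 < e\<close> by (intro bexI[of _ "m i"]) (auto simp: dist_commute min_def split: if_splits)
    qed
  qed
qed

text \<open>Each coordinate is uniformly continuous on the dense set of the points \<open>m i\<close>, and so extends
  to \<open>K\<close>.\<close>
lemma code_decode:
  assumes zu: "(z, u) \<in> codes" and pos: "\<And>k. 0 < z k"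
  obtains f where "continuous_on K f" "f ` K = closure (range u)"
proof -
  have "\<exists>g. continuous_on K g \<and> (\<forall>i. g (m i) = u i l)" for l
  proof -
    have modulus: "\<exists>\<delta>>0. \<forall>i j. dist (m i) (m j) < \<delta> \<longrightarrow> \<bar>u i l - u j l\<bar> < e" if e: "e > 0" for e
    proof -
      obtain n where n: "(1/2::real) ^ n < e"
        using real_arch_pow_inv[OF e, of "1/2"] by auto
      \<comment> \<open>The scale has to be fine enough for \<open>e\<close>, and at least \<open>l\<close> in order to control the coordinate \<open>l\<close>.\<close>
      define k where "k = max n l"
      have "(1/2::real) ^ k \<le> (1/2) ^ n"
        by (intro power_decreasing) (auto simp: k_def)
      then have "(1/2::real) ^ k < e"
        using n by (rule le_less_trans)
      then have k: "(1/2::real) ^ k < e" "l \<le> k"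
        by (simp_all add: k_def)
      show ?thesis
      proof (intro exI[of _ "z k"] conjI allI impI)
        fix i j assume "dist (m i) (m j) < z k"
        then have "\<bar>u i l - u j l\<bar> \<le> (1/2) ^ k"
          using code_modulus[OF zu] k(2) by blast
        with k show "\<bar>u i l - u j l\<bar> < e" by simp
      qed (rule pos)
    qed
    define h where "h y = u (SOME i. m i = y) l" for y
    have h: "h (m i) = u i l" for i
    proof -
      define j where "j = (SOME j. m j = m i)"
      have j: "m j = m i" unfolding j_def by (rule someI[of _ i]) simp
      have "\<bar>u j l - u i l\<bar> < e" if "e > 0" for e
        using modulus[OF that] j by force
      then have "u j l = u i l"
        by (metis abs_0_eq abs_ge_zero eq_iff_diff_eq_0 less_irrefl order_le_less)
      then show ?thesis by (simp add: h_def j_def)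
    qed
    have "uniformly_continuous_on (range m) h"
      unfolding uniformly_continuous_on_def
    proof (intro allI impI)
      fix e :: real assume "0 < e"
      then obtain \<delta> where "\<delta> > 0" "\<And>i j. dist (m i) (m j) < \<delta> \<Longrightarrow> \<bar>u i l - u j l\<bar> < e"
        using modulus by metis
      then show "\<exists>d>0. \<forall>x\<in>range m. \<forall>x'\<in>range m. dist x' x < d \<longrightarrow> dist (h x') (h x) < e"
        by (intro exI[of _ \<delta>]) (auto simp: h dist_real_def)
    qed
    then obtain g where "uniformly_continuous_on (closure (range m)) g"
      "\<And>x. x \<in> range m \<Longrightarrow> h x = g x"
      using uniformly_continuous_on_extension_on_closure[of "range m" h] by metis
    then show ?thesis
      using h uniformly_continuous_imp_continuous dense_m by (intro exI[of _ g]) force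
  qed
  then obtain g where g: "\<And>l. continuous_on K (g l)" "\<And>l i. g l (m i) = u i l"
    by metis
  define f where "f y l = g l y" for y l
  have f: "continuous_on K f"
    unfolding f_def by (intro continuous_on_coordinatewise_then_product g)
  have fm: "f ` range m = range u"
    using g(2) by (auto simp: f_def image_image fun_eq_iff)
  have "f ` K \<subseteq> closure (range u)"
    using image_closure_subset[of "range m" f "closure (range u)"] f fm closure_subset[of "range u"]
    by (simp add: dense_m)
  moreover have "closure (range u) \<subseteq> f ` K"
    using fm m_in compact_continuous_image[OF f compact_K]
    by (intro closure_minimal) (auto simp: compact_imp_closed)
  ultimately show ?thesis using f that by blast
qed

lemma code_exists:
  assumes f: "continuous_on K f" "f ` K \<subseteq> hilbert_cube"
  obtains z where "(z, f \<circ> m) \<in> codes" "\<And>k. 0 < z k" "closure (range (f \<circ> m)) = f ` K"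
proof -
  have "\<exists>\<delta>>0. \<delta> \<le> 1 \<and> (\<forall>i j. dist (m i) (m j) < \<delta> \<longrightarrow> (\<forall>l\<le>k. \<bar>f (m i) l - f (m j) l\<bar> \<le> (1/2) ^ k))"
    for k :: nat
  proof -
    have "\<exists>\<delta>>0. \<forall>x\<in>K. \<forall>y\<in>K. dist y x < \<delta> \<longrightarrow> dist (f y l) (f x l) < (1/2) ^ k" for l
    proof -
      have "continuous_on K (\<lambda>x. f x l)"
        using f(1) by (rule continuous_on_product_then_coordinatewise)
      then have "uniformly_continuous_on K (\<lambda>x. f x l)"
        using compact_K compact_uniformly_continuous by blast
      then show ?thesis
        unfolding uniformly_continuous_on_def by simp
    qed
    then obtain \<delta> where \<delta>: "\<And>l. \<delta> l > 0"
      "\<And>l x y. x \<in> K \<Longrightarrow> y \<in> K \<Longrightarrow> dist y x < \<delta> l \<Longrightarrow> dist (f y l) (f x l) < (1/2) ^ k"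
      by metis
    have "Min (insert 1 (\<delta> ` {..k})) > 0"
      using \<delta>(1) by (subst Min_gr_iff) auto
    moreover have "Min (insert 1 (\<delta> ` {..k})) \<le> \<delta> l" if "l \<le> k" for l
      using that by (intro Min_le) auto
    moreover have "Min (insert 1 (\<delta> ` {..k})) \<le> 1"
      by (intro Min_le) auto
    ultimately show ?thesis
      using \<delta>(2) m_in
      by (intro exI[of _ "Min (insert 1 (\<delta> ` {..k}))"] conjI allI impI)
         (auto simp: dist_real_def range_subsetD intro!: less_imp_le \<delta>(2) intro: less_le_trans)
  qed
  then obtain z where z: "\<And>k. 0 < z k" "\<And>k. z k \<le> 1"
    "\<And>k i j. dist (m i) (m j) < z k \<Longrightarrow> (\<forall>l\<le>k. \<bar>f (m i) l - f (m j) l\<bar> \<le> (1/2) ^ k)"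
    by metis
  have "z \<in> hilbert_cube"
    using z(1,2) by (auto simp: hilbert_cube_def less_imp_le)
  moreover have "f (m i) \<in> hilbert_cube" for i
    using f(2) m_in by blast
  ultimately have code: "(z, f \<circ> m) \<in> codes"
    using z(3) by (fastforce simp: codes_def not_le[symmetric])
  moreover have "closure (range (f \<circ> m)) = f ` K"
  proof
    show "closure (range (f \<circ> m)) \<subseteq> f ` K"
      using m_in compact_continuous_image[OF f(1) compact_K]
      by (intro closure_minimal) (auto simp: compact_imp_closed)
    have "f ` range m \<subseteq> closure (range (f \<circ> m))"
      using closure_subset by (simp only: image_comp)
    then show "f ` K \<subseteq> closure (range (f \<circ> m))"
      using image_closure_subset[of "range m" f "closure (range (f \<circ> m))"] f(1)
      by (simp only: dense_m closed_closure)
  qed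
  ultimately show ?thesis using that z(1) by blast
qed

end

section \<open>Curves that fill unions of cubes\<close>

definition Peano_set :: "'b::topological_space set \<Rightarrow> bool"
  where "Peano_set S \<longleftrightarrow> (\<exists>p. path p \<and> path_image p = S)"

lemma Peano_set_image:
  assumes "Peano_set S" "continuous_on S f"
  shows "Peano_set (f ` S)"
  using assms unfolding Peano_set_def by (metis path_continuous_image path_image_compose)

lemma Peano_set_Un:
  fixes S T :: "'a::topological_space set"
  assumes S: "Peano_set S" and T: "Peano_set T" and meet: "S \<inter> T \<noteq> {}"
  shows "Peano_set (S \<union> T)"
proof -
  obtain p q where p: "path p" "path_image p = S" and q: "path q" "path_image q = T"
    using S T by (auto simp: Peano_set_def)
  obtain s t where s: "s \<in> {0..1}" and t: "t \<in> {0..1}" and pq: "p s = q t"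
  proof -
    obtain w where "w \<in> path_image p" "w \<in> path_image q"
      using meet p(2) q(2) by blast
    then show ?thesis using that by (auto simp: path_image_def)
  qed
  define seg where "seg c a b = c \<circ> (\<lambda>x::real. (1 - x) * a + x * b)" for c :: "real \<Rightarrow> 'a" and a b
  have range: "(\<lambda>x::real. (1 - x) * a + x * b) ` {0..1} \<subseteq> {0..1}" if "a \<in> {0..1}" "b \<in> {0..1}" for a b
    using that convex_bound_le[of a 1 b] by (auto intro!: add_nonneg_nonneg)
  have seg: "path (seg c a b)" "path_image (seg c a b) \<subseteq> path_image c"
    if "path c" "a \<in> {0..1}" "b \<in> {0..1}" for c a b
  proof -
    show "path (seg c a b)"
      unfolding seg_def path_def using that(1) range[OF that(2,3)]
      by (intro continuous_on_compose continuous_intros) (auto simp: path_def intro: continuous_on_subset)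
    show "path_image (seg c a b) \<subseteq> path_image c"
      unfolding seg_def path_image_def using range[OF that(2,3)] by (auto simp: image_comp[symmetric])
  qed
  have ends: "pathstart (seg c a b) = c a" "pathfinish (seg c a b) = c b" for c a b
    by (simp_all add: seg_def pathstart_def pathfinish_def)
  have unit: "0 \<in> {0..1::real}" "1 \<in> {0..1::real}" by auto
  \<comment> \<open>Run through \<open>S\<close>, back to a common point, from there to the start of the second curve, and
    through \<open>T\<close>.\<close>
  define r where "r = p +++ (seg p 1 s +++ (seg q t 0 +++ q))"
  have fit: "pathfinish (seg q t 0) = pathstart q"
    "pathfinish (seg p 1 s) = pathstart (seg q t 0 +++ q)"
    "pathfinish p = pathstart (seg p 1 s +++ (seg q t 0 +++ q))"
    using pq by (simp_all add: ends) (simp_all add: pathstart_def pathfinish_def)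
  have "path r"
    unfolding r_def using fit p(1) q(1) seg(1) s t unit by (intro path_join_imp) auto
  moreover have "path_image r = path_image p \<union> (path_image (seg p 1 s) \<union> (path_image (seg q t 0) \<union> path_image q))"
    unfolding r_def using fit by (simp add: path_image_join)
  then have "path_image r = S \<union> T"
    using seg(2)[OF p(1) unit(2) s] seg(2)[OF q(1) t unit(1)] p(2) q(2) by blast
  ultimately show ?thesis unfolding Peano_set_def by blast
qed

text \<open>The hypothesis \<open>linked\<close> says that the intersection graph is connected. A maximal subfamily
  whose union is a curve must then be the whole family.\<close>
lemma Peano_set_UN:
  assumes fin: "finite I" "I \<noteq> {}" and F: "\<And>i. i \<in> I \<Longrightarrow> Peano_set (F i)"
    and linked: "\<And>J. J \<subseteq> I \<Longrightarrow> J \<noteq> {} \<Longrightarrow> J \<noteq> I \<Longrightarrow> \<exists>i\<in>J. \<exists>j\<in>I - J. F i \<inter> F j \<noteq> {}"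
  shows "Peano_set (\<Union>i\<in>I. F i)"
proof -
  define \<J> where "\<J> = {J. J \<subseteq> I \<and> J \<noteq> {} \<and> Peano_set (\<Union>i\<in>J. F i)}"
  obtain i where "i \<in> I" using fin by blast
  then have "{i} \<in> \<J>" using F by (simp add: \<J>_def)
  moreover have "finite \<J>" using fin(1) by (simp add: \<J>_def)
  ultimately obtain J where J: "J \<in> \<J>" "\<And>J'. J' \<in> \<J> \<Longrightarrow> J \<subseteq> J' \<Longrightarrow> J = J'"
    using finite_has_maximal[of \<J>] by blast
  have "J = I"
  proof (rule ccontr)
    assume "J \<noteq> I"
    then obtain a j where aj: "a \<in> J" "j \<in> I - J" "F a \<inter> F j \<noteq> {}"
      using linked[of J] J(1) unfolding \<J>_def by blast
    have "Peano_set ((\<Union>i\<in>J. F i) \<union> F j)"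
      using J(1) aj F unfolding \<J>_def by (intro Peano_set_Un) auto
    moreover have "(\<Union>i\<in>J. F i) \<union> F j = (\<Union>i\<in>insert j J. F i)" by blast
    ultimately have "insert j J \<in> \<J>"
      using J(1) aj unfolding \<J>_def by auto
    then show False using J(2) aj by blast
  qed
  then show ?thesis using J(1) by (simp add: \<J>_def)
qed

text \<open>A continuous function of period 2 that is 0 at distance at most \<open>1/3\<close> from the even integers and 1 at
  distance at most \<open>1/3\<close> from the odd ones, so that it reads off binary digits with some tolerance.\<close>
definition plateau :: "real \<Rightarrow> real"
  where "plateau s = max 0 (min 1 (1/2 - cos (pi * s)))"

lemma plateau_digit:
  assumes "b \<in> {0, 1::real}" "0 \<le> r" "r \<le> 1/3"
  shows "plateau (2 * real N + b + r) = b"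
proof -
  have "cos (pi / 3) \<le> cos (pi * r)"
    using assms by (intro cos_monotone_0_pi_le) auto
  then have c: "1/2 \<le> cos (pi * r)" by (simp add: cos_60)
  have "cos (pi * (2 * real N + b + r)) = cos (pi * b + pi * r + 2 * real N * pi)"
    by (simp add: algebra_simps)
  also have "\<dots> = cos (pi * b + pi * r)"
    by (simp add: cos_add[of _ "2 * real N * pi"] cos_2npi sin_2npi del: cos_add)
  finally have e: "cos (pi * (2 * real N + b + r)) = cos (pi * b + pi * r)" .
  show ?thesis
  proof (cases "b = 0")
    case True
    then show ?thesis using c e by (simp add: plateau_def)
  next
    case False
    then have b: "b = 1" using assms by simp
    then have "cos (pi * (2 * real N + b + r)) = - cos (pi * r)"
      using e by (simp add: cos_add)
    then show ?thesis using c b by (simp add: plateau_def)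
  qed
qed

text \<open>The witness is \<open>\<Sum>n. b n / 4 ^ n\<close>: after multiplication by \<open>4 ^ k\<close> the earlier terms add up
  to an even integer, and the later ones to at most \<open>1/3\<close>.\<close>
lemma all_digits:
  fixes b :: "nat \<Rightarrow> real"
  assumes b: "\<And>n. b n \<in> {0, 1}"
  shows "\<exists>t\<in>{0..2}. \<forall>k. plateau (4 ^ k * t) = b k"
proof -
  have b01: "0 \<le> b n" "b n \<le> 1" for n
    using b[of n] by auto
  have geo: "summable (\<lambda>n. (1/4::real) ^ n)" "(\<Sum>n. (1/4::real) ^ n) = 4/3"
    by (simp_all add: suminf_geometric)
  have le: "b (n + k) * (1/4) ^ n \<le> (1/4) ^ n" "0 \<le> b (n + k) * (1/4) ^ n" for n k
    using b01[of "n + k"] by (auto intro: mult_left_le_one_le)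
  have sm: "summable (\<lambda>n. b (n + k) * (1/4) ^ n)" for k
    using le by (intro summable_comparison_test'[OF geo(1), of 0]) auto
  define t where "t k = (\<Sum>n. b (n + k) * (1/4) ^ n)" for k
  have t_bounds: "0 \<le> t k" "t k \<le> 4/3" for k
    unfolding t_def geo(2)[symmetric] using le sm geo(1)
    by (auto intro!: suminf_nonneg suminf_le)
  have t_Suc: "t k = b k + t (Suc k) / 4" for k
  proof -
    have "t k = b k + (\<Sum>n. b (Suc n + k) * (1/4) ^ Suc n)"
      unfolding t_def using suminf_split_head[OF sm[of k]] by simp
    also have "(\<Sum>n. b (Suc n + k) * (1/4) ^ Suc n) = t (Suc k) / 4"
      unfolding t_def using suminf_divide[OF sm[of "Suc k"], of 4] by (simp add: field_simps)
    finally show ?thesis .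
  qed
  have shift: "\<exists>N. 4 ^ k * t 0 = 2 * real N + t k" for k
  proof (induction k)
    case 0
    show ?case by (intro exI[of _ 0]) simp
  next
    case (Suc k)
    then obtain N where N: "4 ^ k * t 0 = 2 * real N + t k" by blast
    have "4 ^ Suc k * t 0 = 2 * (4 * real N + 2 * b k) + t (Suc k)"
      using N t_Suc[of k] by simp
    moreover have "b k = 0 \<or> b k = 1" using b[of k] by simp
    then have "\<exists>N'. 4 * real N + 2 * b k = real N'"
      by (elim disjE) (auto intro: exI[of _ "4 * N"] exI[of _ "4 * N + 2"])
    ultimately show ?case by metis
  qed
  show ?thesis
  proof (intro bexI[of _ "t 0"] allI)
    fix k
    obtain N where "4 ^ k * t 0 = 2 * real N + b k + t (Suc k) / 4"
      using shift[of k] t_Suc[of k] by auto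
    then show "plateau (4 ^ k * t 0) = b k"
      using plateau_digit[OF b[of k], of "t (Suc k) / 4" N] t_bounds[of "Suc k"] by simp
  qed (use t_bounds[of 0] in auto)
qed

lemma binary_expansion:
  fixes x :: real
  assumes "x \<in> {0..1}"
  shows "\<exists>b. (\<forall>n. b n \<in> {0, 1}) \<and> (\<lambda>n. b n * (1/2) ^ Suc n) sums x"
proof -
  define r where "r = rec_nat x (\<lambda>_ r. if r \<ge> 1/2 then 2 * r - 1 else 2 * r)"
  define b where "b n = (if r n \<ge> 1/2 then 1 else 0 :: real)" for n
  have r0: "r 0 = x" and rS: "r (Suc n) = 2 * r n - b n" for n
    by (auto simp: r_def b_def)
  have r: "0 \<le> r n \<and> r n \<le> 1" for n
    by (induction n) (use assms in \<open>auto simp: r0 rS b_def\<close>)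
  have partial: "(\<Sum>j<n. b j * (1/2) ^ Suc j) = x - r n * (1/2) ^ n" for n
    by (induction n) (auto simp: r0 rS field_simps)
  have "(\<lambda>n. r n * (1/2) ^ n) \<longlonglongrightarrow> 0"
  proof (rule Lim_null_comparison)
    show "\<forall>\<^sub>F n in sequentially. norm (r n * (1/2) ^ n) \<le> (1/2) ^ n"
      using r by (intro always_eventually allI) (auto simp: abs_mult intro: mult_left_le_one_le)
    show "(\<lambda>n. (1/2::real) ^ n) \<longlonglongrightarrow> 0"
      by (intro LIMSEQ_power_zero) simp
  qed
  then have "(\<lambda>n. x - r n * (1/2) ^ n) \<longlonglongrightarrow> x - 0"
    by (intro tendsto_diff tendsto_const)
  then have "(\<lambda>n. b n * (1/2) ^ Suc n) sums x"
    by (simp add: sums_def partial del: power_Suc)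
  then show ?thesis
    by (intro exI[of _ b]) (auto simp: b_def)
qed

text \<open>This is Schoenberg's space-filling curve with one digit stream for each coordinate.\<close>
theorem Peano_set_hilbert_cube: "Peano_set hilbert_cube"
proof -
  define g where "g t i = (\<Sum>n. plateau (4 ^ prod_encode (i, n) * (2 * t)) * (1/2) ^ Suc n)"
    for t :: real and i
  have half: "(\<lambda>n. (1/2::real) ^ Suc n) sums 1"
    using power_half_series by simp
  have pl: "0 \<le> plateau s" "plateau s \<le> 1" for s
    by (auto simp: plateau_def)
  have le: "0 \<le> plateau s * (1/2) ^ Suc n" "plateau s * (1/2) ^ Suc n \<le> (1/2) ^ Suc n" for s n
    using pl by (auto intro!: mult_left_le_one_le mult_nonneg_nonneg)
  have "continuous_on {0..1} (\<lambda>t. g t i)" for i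
  proof (rule uniform_limit_theorem)
    show "uniform_limit {0..1} (\<lambda>N t. \<Sum>n<N. plateau (4 ^ prod_encode (i, n) * (2 * t)) * (1/2) ^ Suc n)
        (\<lambda>t. g t i) sequentially"
      unfolding g_def using le half
      by (intro Weierstrass_m_test[where M = "\<lambda>n. (1/2) ^ Suc n"]) (auto simp: sums_iff)
    show "\<forall>\<^sub>F N in sequentially. continuous_on {0..1}
        (\<lambda>t. \<Sum>n<N. plateau (4 ^ prod_encode (i, n) * (2 * t)) * (1/2) ^ Suc n)"
      unfolding plateau_def by (intro always_eventually allI continuous_intros)
  qed simp
  then have "path g"
    unfolding path_def by (intro continuous_on_coordinatewise_then_product)
  moreover have "g t \<in> hilbert_cube" for t
  proof -
    have "0 \<le> g t i \<and> g t i \<le> 1" for i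
    proof -
      have s: "summable (\<lambda>n. plateau (4 ^ prod_encode (i, n) * (2 * t)) * (1/2) ^ Suc n)"
        using le by (intro summable_comparison_test'[OF sums_summable[OF half], of 0]) auto
      have "g t i \<le> (\<Sum>n. (1/2) ^ Suc n)"
        unfolding g_def by (rule suminf_le[OF le(2) s sums_summable[OF half]])
      moreover have "0 \<le> g t i"
        unfolding g_def by (rule suminf_nonneg[OF s le(1)])
      ultimately show ?thesis using half by (simp add: sums_iff)
    qed
    then show ?thesis by (simp add: hilbert_cube_def)
  qed
  moreover have "y \<in> path_image g" if y: "y \<in> hilbert_cube" for y
  proof -
    have "\<exists>b. (\<forall>n. b n \<in> {0, 1}) \<and> (\<lambda>n. b n * (1/2) ^ Suc n) sums y i" for i
      using y by (intro binary_expansion) (simp add: hilbert_cube_def)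
    then obtain b where b: "\<And>i n. b i n \<in> {0, 1}" "\<And>i. (\<lambda>n. b i n * (1/2) ^ Suc n) sums y i"
      by metis
    obtain t where t: "t \<in> {0..2}" "\<And>k. plateau (4 ^ k * t) = case_prod b (prod_decode k)"
      using all_digits[of "\<lambda>k. case_prod b (prod_decode k)"] b(1) by (metis case_prod_beta)
    have "g (t / 2) i = y i" for i
      using b(2)[of i] t(2) by (simp add: g_def sums_iff)
    then have "g (t / 2) = y" by blast
    then show ?thesis
      unfolding path_image_def using t(1) by (intro image_eqI[of _ _ "t / 2"]) auto
  qed
  ultimately show ?thesis
    unfolding Peano_set_def path_image_def by (intro exI[of _ g]) blast
qed

context net_sequence
begin

text \<open>The cube is retracted onto a cell by cutting off the coordinates up to \<open>k\<close>. The centre has to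
  lie in the cube for the result to stay there.\<close>
lemma Peano_set_cell:
  assumes c: "c \<in> hilbert_cube"
  shows "Peano_set (cell k c)"
proof -
  define \<rho> where "\<rho> = 2 * (1/2::real) ^ k"
  have \<rho>: "0 < \<rho>" by (simp add: \<rho>_def)
  define clamp where "clamp x l = (if l \<le> k then max (c l - \<rho>) (min (c l + \<rho>) (x l)) else x l)"
    for x :: "nat \<Rightarrow> real" and l
  have "continuous_on hilbert_cube (\<lambda>x. clamp x l)" for l
  proof -
    have "continuous_on hilbert_cube (\<lambda>x :: nat \<Rightarrow> real. x l)"
      using continuous_on_subset[OF continuous_coordinates(1)] by blast
    then show ?thesis
      unfolding clamp_def by (cases "l \<le> k") (auto intro!: continuous_on_max continuous_on_min continuous_on_const)
  qed
  then have "continuous_on hilbert_cube clamp"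
    by (intro continuous_on_coordinatewise_then_product)
  then have "Peano_set (clamp ` hilbert_cube)"
    using Peano_set_hilbert_cube Peano_set_image by blast
  moreover have "clamp ` hilbert_cube = cell k c"
  proof (intro equalityI subsetI)
    fix y assume "y \<in> clamp ` hilbert_cube"
    then obtain x where x: "x \<in> hilbert_cube" "y = clamp x" by blast
    have "0 \<le> y l \<and> y l \<le> 1 \<and> (l \<le> k \<longrightarrow> \<bar>y l - c l\<bar> \<le> \<rho>)" for l
    proof -
      have "0 \<le> x l" "x l \<le> 1" "0 \<le> c l" "c l \<le> 1"
        using x(1) c by (auto simp: hilbert_cube_def)
      then show ?thesis using \<rho> x(2) by (auto simp: clamp_def max_def min_def abs_if)
    qed
    then show "y \<in> cell k c" by (simp add: cell_def hilbert_cube_def \<rho>_def)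
  next
    fix y assume y: "y \<in> cell k c"
    have "clamp y l = y l" for l
    proof (cases "l \<le> k")
      case True
      then have "\<bar>y l - c l\<bar> \<le> \<rho>" using y by (simp add: cell_def \<rho>_def)
      then show ?thesis by (auto simp: clamp_def max_def min_def abs_if split: if_splits)
    qed (simp add: clamp_def)
    then have "clamp y = y" by blast
    then show "y \<in> clamp ` hilbert_cube" using y by (force simp: cell_def)
  qed
  ultimately show ?thesis by simp
qed

text \<open>Balls of radius \<open>z k / 2\<close> around the net cover \<open>K\<close>, so by connectedness the net cannot be
  split into two parts without two of these balls, one from each part, meeting in \<open>K\<close>. Their
  centres are then so close that the cells around their values meet.\<close>
lemma Peano_set_stage:
  assumes zu: "(z, u) \<in> codes" and zk: "0 < z k" and K: "connected K" "K \<noteq> {}"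
  shows "Peano_set (stage k (z k) u)"
  unfolding stage_def
proof (rule Peano_set_UN)
  let ?I = "{i. z k \<le> \<tau> i}"
  have cover: "\<exists>i\<in>?I. dist y (m i) < z k / 2" if "y \<in> K" for y
    using net[OF zk _ that] code_bounds[OF zu, of k] by auto
  show "finite ?I" by (rule finite_net[OF zk])
  show "?I \<noteq> {}" using cover K(2) by blast
  show "Peano_set (cell k (u i))" for i
    by (rule Peano_set_cell[OF code_cube(1)[OF zu]])
  fix J assume J: "J \<subseteq> ?I" "J \<noteq> {}" "J \<noteq> ?I"
  define near where "near A = (\<Union>i\<in>A. ball (m i) (z k / 2))" for A
  have "near J \<inter> near (?I - J) \<inter> K \<noteq> {}"
  proof (rule ccontr)
    assume no: "\<not> near J \<inter> near (?I - J) \<inter> K \<noteq> {}"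
    have "K \<subseteq> near J \<union> near (?I - J)"
    proof
      fix y assume "y \<in> K"
      then obtain i where "i \<in> ?I" "dist y (m i) < z k / 2" using cover by blast
      then show "y \<in> near J \<union> near (?I - J)"
        by (cases "i \<in> J") (auto simp: near_def dist_commute)
    qed
    moreover have "open (near J)" "open (near (?I - J))" by (auto simp: near_def)
    ultimately have empty: "near J \<inter> K = {} \<or> near (?I - J) \<inter> K = {}"
      using connectedD[OF K(1), of "near J" "near (?I - J)"] no by blast
    have "near A \<inter> K \<noteq> {}" if "A \<noteq> {}" for A
    proof -
      obtain i where "i \<in> A" using \<open>A \<noteq> {}\<close> by blast
      moreover have "m i \<in> ball (m i) (z k / 2)" using zk by simp
      ultimately have "m i \<in> near A" unfolding near_def by blast
      then show ?thesis using m_in by blast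
    qed
    from this[OF J(2)] this[of "?I - J"] have "near J \<inter> K \<noteq> {}" "near (?I - J) \<inter> K \<noteq> {}"
      using J(1,3) by blast+
    then show False using empty by simp
  qed
  then obtain y where y: "y \<in> near J" "y \<in> near (?I - J)"
    by blast
  obtain i where i: "i \<in> J" "dist (m i) y < z k / 2"
    using y(1) unfolding near_def mem_ball[symmetric] by blast
  obtain j where j: "j \<in> ?I - J" "dist (m j) y < z k / 2"
    using y(2) unfolding near_def mem_ball[symmetric] by blast
  have "dist (m i) (m j) < z k"
    using i(2) j(2) dist_triangle2[of "m i" "m j" y] by simp
  then have "\<bar>u i l - u j l\<bar> \<le> (1/2) ^ k" if "l \<le> k" for l
    using code_modulus[OF zu] that by blast
  then have "u i \<in> cell k (u j)" "u i \<in> cell k (u i)"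
    using code_cube(1)[OF zu] by (fastforce simp: cell_def)+
  then show "\<exists>i\<in>J. \<exists>j\<in>?I - J. cell k (u i) \<inter> cell k (u j) \<noteq> {}"
    using i(1) j(1) by blast
qed

text \<open>If \<open>j\<close> is the position of the first zero, only the approximations at the scales below \<open>j\<close> are
  imposed. As they decrease, the last one is the fibre, or the whole cube if \<open>j = 0\<close>.\<close>
lemma irregular_fibre:
  assumes zu: "(z, u) \<in> codes" and zn: "z n = 0" and K: "connected K" "K \<noteq> {}"
  shows "Peano_set {x. ((z, u), x) \<in> total_space}"
proof -
  define j where "j = (LEAST j. z j = 0)"
  have j: "z j = 0" and below: "\<And>i. i < j \<Longrightarrow> 0 < z i"
  proof -
    show "z j = 0" unfolding j_def using zn by (rule LeastI)
    show "0 < z i" if "i < j" for i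
      using not_less_Least[of i "\<lambda>j. z j = 0"] that code_bounds[OF zu, of i]
      by (auto simp: j_def order_less_le)
  qed
  have zero: "(\<exists>i\<le>k. z i = 0) \<longleftrightarrow> j \<le> k" for k
    using j below by (metis less_irrefl not_le order_trans)
  have fibre: "{x. ((z, u), x) \<in> total_space} = {x \<in> hilbert_cube. \<forall>k<j. x \<in> stage k (z k) u}"
  proof -
    have "(\<forall>k. j \<le> k \<or> x \<in> stage k (z k) u) \<longleftrightarrow> (\<forall>k<j. x \<in> stage k (z k) u)" for x
      by (meson not_le)
    then show ?thesis by (simp add: total_space_def zero zu)
  qed
  show ?thesis
  proof (cases j)
    case 0
    then show ?thesis using fibre Peano_set_hilbert_cube by simp
  next
    case (Suc k)
    have "stage k (z k) u \<subseteq> stage i (z i) u" if "i \<le> k" for i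
      using that
    proof (induction rule: inc_induct)
      case (step i)
      then show ?case
        using stage_Suc_subset[OF zu below[of i], of "z (Suc i)"] Suc by auto
    qed simp
    moreover have "stage k (z k) u \<subseteq> hilbert_cube"
      by (auto simp: stage_def cell_def)
    ultimately have "{x. ((z, u), x) \<in> total_space} = stage k (z k) u"
      unfolding fibre Suc less_Suc_eq_le by blast
    then show ?thesis
      using Peano_set_stage[OF zu below K, of k] Suc by simp
  qed
qed

end

section \<open>Compositions\<close>

lemma fibres_fst_equivalent:
  assumes "fst ` A \<subseteq> B"
  shows "fibres (top_of_set A) (top_of_set B) fst \<cong>\<^sub>C (\<lambda>b. top_of_set {x. (b, x) \<in> A}) ` B"
proof -
  have hom: "subtopology (top_of_set A) {p \<in> topspace (top_of_set A). fst p = b}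
      homeomorphic_space top_of_set {x. (b, x) \<in> A}" for b
  proof -
    have "homeomorphic_maps (top_of_set {p \<in> A. fst p = b}) (top_of_set {x. (b, x) \<in> A}) snd (Pair b)"
      by (auto simp: homeomorphic_maps_def intro!: continuous_intros)
    moreover have "subtopology (top_of_set A) {p \<in> topspace (top_of_set A). fst p = b}
        = top_of_set {p \<in> A. fst p = b}"
      by (simp add: subtopology_subtopology Int_def)
    ultimately show ?thesis
      unfolding homeomorphic_space_def by metis
  qed
  show ?thesis
    unfolding equivalent_classes_def fibres_def
  proof (intro conjI ballI)
    fix X assume "X \<in> {subtopology (top_of_set A) {x \<in> topspace (top_of_set A). fst x = b} |b.
      b \<in> topspace (top_of_set B)}"
    then show "\<exists>Y\<in>(\<lambda>b. top_of_set {x. (b, x) \<in> A}) ` B. X homeomorphic_space Y"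
      using hom by auto
  next
    fix Y assume "Y \<in> (\<lambda>b. top_of_set {x. (b, x) \<in> A}) ` B"
    then show "\<exists>X\<in>{subtopology (top_of_set A) {x \<in> topspace (top_of_set A). fst x = b} |b.
        b \<in> topspace (top_of_set B)}. Y homeomorphic_space X"
      using hom homeomorphic_space_sym by fastforce
  qed
qed

lemma connected_onto_unit_interval:
  fixes K :: "'b::metric_space set"
  assumes K: "connected K" "x \<in> K" "y \<in> K" "x \<noteq> y"
  obtains h :: "'b \<Rightarrow> real" where "continuous_on K h" "h ` K = {0..1}"
proof -
  define h where "h t = min 1 (dist x t / dist x y)" for t
  have cont: "continuous_on K h"
    unfolding h_def using K(4) by (intro continuous_intros) auto
  have "h x = 0" "h y = 1" using K(4) by (auto simp: h_def)
  then have ends: "0 \<in> h ` K" "1 \<in> h ` K" using K(2,3) by (metis imageI)+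
  have "connected (h ` K)" using cont K(1) by (rule connected_continuous_image)
  then have "{0..1} \<subseteq> h ` K"
    using ends by (metis connected_contains_Icc)
  moreover have "h ` K \<subseteq> {0..1}" by (auto simp: h_def)
  ultimately show ?thesis using cont that by blast
qed

context net_sequence
begin

lemma regular_fibre_image_compactum:
  assumes zu: "(z, u) \<in> codes" and pos: "\<And>k. 0 < z k"
  shows "closure (range u) \<in> image_compacta K"
proof -
  have "closure (range u) \<subseteq> hilbert_cube"
    using code_cube(1)[OF zu] compact_imp_closed[OF compact_hilbert_cube]
    by (intro closure_minimal) auto
  moreover obtain f where "continuous_on K f" "f ` K = closure (range u)"
    by (rule code_decode[OF zu pos])
  ultimately show ?thesis
    unfolding image_compacta_def by blast
qed

text \<open>These codes carry a full modulus of continuity, so each of them describes a map.\<close>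
definition regular :: "((nat \<Rightarrow> real) \<times> (nat \<Rightarrow> nat \<Rightarrow> real)) set"
  where "regular = {b \<in> codes. \<forall>k. 0 < fst b k}"

lemma regular_slice:
  "{x. (b, x) \<in> {p \<in> total_space. fst p \<in> regular}} = closure (range (snd b))" if "b \<in> regular"
proof -
  obtain z u where b: "b = (z, u)" by (metis surj_pair)
  then have "(z, u) \<in> codes" "\<And>k. 0 < z k" using that by (auto simp: regular_def)
  from regular_fibre[OF this] that b show ?thesis by simp
qed

lemma Polish_topology_closed_Int_regular:
  fixes T :: "'c::{complete_space, second_countable_topology} set" and h :: "nat \<Rightarrow> 'c \<Rightarrow> real"
  assumes "closed T" "\<And>k. continuous_on UNIV (h k)"
  shows "Polish_topology (top_of_set {p \<in> T. \<forall>k. 0 < h k p})"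
proof -
  let ?S = "{p \<in> T. \<forall>k. 0 < h k p}"
  have "gdelta_in euclidean {p. 0 < h k p}" for k
  proof -
    have "open {p. 0 < h k p}"
      by (intro open_Collect_less continuous_on_const assms(2))
    then show ?thesis by (metis open_imp_gdelta_in open_openin)
  qed
  then have "gdelta_in euclidean (\<Inter>k. {p. 0 < h k p})"
    by (intro gdelta_in_Inter) auto
  moreover have "gdelta_in euclidean T"
    using assms(1) by (intro closed_imp_gdelta_in) (auto simp: metrizable_space_euclidean)
  ultimately have "gdelta_in euclidean (T \<inter> (\<Inter>k. {p. 0 < h k p}))"
    by (intro gdelta_in_Int)
  moreover have "T \<inter> (\<Inter>k. {p. 0 < h k p}) = ?S" by auto
  ultimately have "completely_metrizable_space (top_of_set ?S)"
    using completely_metrizable_space_gdelta_in[OF completely_metrizable_space_euclidean] by metis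
  moreover have "second_countable (euclidean :: 'c topology)"
  proof -
    obtain \<B> :: "'c set set" where \<B>: "countable \<B>" "topological_basis \<B>"
      using ex_countable_basis by blast
    have "\<exists>V\<in>\<B>. x \<in> V \<and> V \<subseteq> U" if "open U" "x \<in> U" for U x
      using topological_basisE[OF \<B>(2) that] by metis
    then show ?thesis
      unfolding second_countable_def
      using \<B>(1) topological_basis_open[OF \<B>(2)]
      by (intro allI impI exI[of _ \<B>]) (simp flip: open_openin)
  qed
  then have "separable_space (top_of_set ?S)"
    by (intro second_countable_imp_separable_space second_countable_subtopology)
  ultimately show ?thesis by (simp add: Polish_topology_def)
qed

text \<open>The codes without zeros form a Polish space, because positivity is a \<open>G\<^sub>\<delta>\<close> condition. The
  projection of the pairs of such a code and a point of its image is closed by compactness of the cube.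
  It is open because the values \<open>u i\<close>, which depend continuously on the code, are dense in the
  image.\<close>
proposition image_compacta_strongly_Polishable:
  assumes C: "top_of_set ` image_compacta K \<cong>\<^sub>C C"
  shows "strongly_Polishable C"
proof (rule strongly_PolishableI)
  define A where "A = {p \<in> total_space. fst p \<in> regular}"
  have fibre: "{x. (b, x) \<in> A} = closure (range (snd b))" if "b \<in> regular" for b
    unfolding A_def by (rule regular_slice[OF that])
  have A_iff: "(b, x) \<in> A \<longleftrightarrow> b \<in> regular \<and> x \<in> closure (range (snd b))" for b x
    using fibre[of b] by (cases "b \<in> regular") (blast, simp add: A_def)
  have onto: "fst ` A = regular"
  proof
    show "regular \<subseteq> fst ` A"
    proof
      fix b assume "b \<in> regular"
      then have "(b, snd b 0) \<in> A" using closure_subset[of "range (snd b)"] by (auto simp: A_iff)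
      then show "b \<in> fst ` A" by force
    qed
  qed (auto simp: A_def)
  have A: "A = {p \<in> total_space. \<forall>k. 0 < fst (fst p) k}"
    by (auto simp: A_def regular_def total_space_def)
  show "Polish_topology (top_of_set A)"
    unfolding A using compact_imp_closed[OF compact_total_space] continuous_coordinates(5)
    by (rule Polish_topology_closed_Int_regular)
  show "Polish_topology (top_of_set regular)"
    unfolding regular_def using compact_imp_closed[OF compact_codes] continuous_coordinates(2)
    by (rule Polish_topology_closed_Int_regular)
  show "continuous_map (top_of_set A) (top_of_set regular) fst"
    using onto by (auto intro!: continuous_intros)
  show "closed_map (top_of_set A) (top_of_set regular) fst"
  proof -
    have closed: "closed_map (prod_topology (top_of_set regular) (top_of_set hilbert_cube))
        (top_of_set regular) fst"
      by (intro Abstract_Topological_Spaces.closed_map_fst)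
        (simp add: compact_space_subtopology compact_hilbert_cube)
    have prod: "prod_topology (top_of_set regular) (top_of_set hilbert_cube)
        = top_of_set (regular \<times> hilbert_cube)"
      by (simp add: subtopology_Times[symmetric] euclidean_product_topology)
    have "A = (regular \<times> hilbert_cube) \<inter> total_space"
      by (auto simp: A_def total_space_def)
    then have cl: "closedin (top_of_set (regular \<times> hilbert_cube)) A"
      using compact_imp_closed[OF compact_total_space] by (metis closedin_closed_Int)
    show ?thesis
      unfolding closed_map_def
    proof (intro allI impI)
      fix S assume "closedin (top_of_set A) S"
      then have "closedin (top_of_set (regular \<times> hilbert_cube)) S"
        using cl closedin_trans by blast
      then show "closedin (top_of_set regular) (fst ` S)"
        using closed unfolding prod closed_map_def by blast
    qed
  qed
  show "open_map (top_of_set A) (top_of_set regular) fst"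
    unfolding open_map_def
  proof (intro allI impI)
    fix U assume "openin (top_of_set A) U"
    then obtain W where W: "open W" "U = A \<inter> W" by (auto simp: openin_open)
    have slice: "open ((\<lambda>b. (b, snd b i)) -` W)" for i
    proof -
      have "continuous_on UNIV (\<lambda>b :: (nat \<Rightarrow> real) \<times> (nat \<Rightarrow> nat \<Rightarrow> real). snd b i)"
        by (rule continuous_on_product_then_coordinatewise) (intro continuous_intros)
      then have "continuous_on UNIV (\<lambda>b :: (nat \<Rightarrow> real) \<times> (nat \<Rightarrow> nat \<Rightarrow> real). (b, snd b i))"
        by (intro continuous_on_Pair continuous_on_id)
      then show ?thesis using W(1) by (simp add: open_vimage)
    qed
    \<comment> \<open>The fibre is the closure of the listed values, so an open set that meets it contains one of
      them.\<close>
    have "fst ` U = regular \<inter> (\<Union>i. (\<lambda>b. (b, snd b i)) -` W)"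
    proof (intro equalityI subsetI)
      fix b assume "b \<in> fst ` U"
      then obtain x where x: "(b, x) \<in> W" "b \<in> regular" "x \<in> closure (range (snd b))"
        using W(2) by (auto simp: A_iff)
      have "open (Pair b -` W)"
        using W(1) by (intro open_vimage continuous_intros)
      then obtain i where "snd b i \<in> Pair b -` W"
        using x(1,3) closure_iff_nhds_not_empty[of x "range (snd b)"] by blast
      with x show "b \<in> regular \<inter> (\<Union>i. (\<lambda>b. (b, snd b i)) -` W)" by auto
    next
      fix b assume "b \<in> regular \<inter> (\<Union>i. (\<lambda>b. (b, snd b i)) -` W)"
      then obtain i where i: "b \<in> regular" "(b, snd b i) \<in> W" by auto
      have "snd b i \<in> closure (range (snd b))" using closure_subset[of "range (snd b)"] by auto
      with i have "(b, snd b i) \<in> U" by (simp add: W(2) A_iff)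
      then show "b \<in> fst ` U" by force
    qed
    then show "openin (top_of_set regular) (fst ` U)"
      using slice by (simp add: openin_open_Int open_UN)
  qed
  show "finite (topspace (top_of_set regular) - fst ` topspace (top_of_set A))"
    "card (topspace (top_of_set regular) - fst ` topspace (top_of_set A)) \<le> 1"
    using onto by simp_all
  have "(\<lambda>b. top_of_set {x. (b, x) \<in> A}) ` regular \<cong>\<^sub>C top_of_set ` image_compacta K"
    unfolding equivalent_classes_def
  proof (intro conjI ballI)
    fix X assume "X \<in> (\<lambda>b. top_of_set {x. (b, x) \<in> A}) ` regular"
    then obtain b where b: "b \<in> regular" "X = top_of_set (closure (range (snd b)))"
      using fibre by auto
    moreover have "closure (range (snd b)) \<in> image_compacta K"
      using regular_fibre_image_compactum[of "fst b" "snd b"] b by (simp add: regular_def)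
    ultimately show "\<exists>Y\<in>top_of_set ` image_compacta K. X homeomorphic_space Y"
      using homeomorphic_space_refl by blast
  next
    fix Y assume "Y \<in> top_of_set ` image_compacta K"
    then obtain f where f: "continuous_on K f" "f ` K \<subseteq> hilbert_cube" "Y = top_of_set (f ` K)"
      by (auto simp: image_compacta_def)
    then obtain z where "(z, f \<circ> m) \<in> codes" "\<And>k. 0 < z k" "closure (range (f \<circ> m)) = f ` K"
      using code_exists by metis
    then have "(z, f \<circ> m) \<in> regular" "{x. ((z, f \<circ> m), x) \<in> A} = f ` K"
      using fibre[of "(z, f \<circ> m)"] by (simp_all add: regular_def)
    then have "Y \<in> (\<lambda>b. top_of_set {x. (b, x) \<in> A}) ` regular"
      using f(3) by (intro image_eqI[of _ _ "(z, f \<circ> m)"]) simp_all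
    then show "\<exists>X\<in>(\<lambda>b. top_of_set {x. (b, x) \<in> A}) ` regular. Y homeomorphic_space X"
      using homeomorphic_space_refl[of Y] by (rule bexI[rotated])
  qed
  from equivalent_classes_trans[OF equivalent_classes_trans[OF
      fibres_fst_equivalent[OF equalityD1[OF onto]] this] C]
  show "fibres (top_of_set A) (top_of_set regular) fst \<cong>\<^sub>C C" .
qed

text \<open>The factors form a product in order that a zero of \<open>z\<close> at \<open>k\<close> kills all coordinates
  from \<open>k\<close> on. Near such a code the coordinates that are not controlled by the modulus are
  therefore small, so they leave no trace in the limit.\<close>
definition squeeze :: "(nat \<Rightarrow> real) \<Rightarrow> (nat \<Rightarrow> real) \<Rightarrow> nat \<Rightarrow> real"
  where "squeeze z x j = (\<Prod>i\<le>j. z i) * x j"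

lemma continuous_on_squeeze: "continuous_on S (squeeze z)"
  unfolding squeeze_def
  by (intro continuous_on_coordinatewise_then_product continuous_on_mult continuous_on_const
      continuous_on_subset[OF continuous_coordinates(1)]) simp

lemma inj_squeeze: "(\<And>k. 0 < z k) \<Longrightarrow> inj (squeeze z)"
proof (intro injI ext)
  fix x y j
  assume pos: "\<And>k. 0 < z k" and eq: "squeeze z x = squeeze z y"
  have "0 < (\<Prod>i\<le>j. z i)"
    using pos by (intro prod_pos) simp
  then show "x j = y j"
    using fun_cong[OF eq, of j] unfolding squeeze_def by (metis mult_left_cancel less_irrefl)
qed

lemma squeeze_hilbert_cube:
  assumes "z \<in> hilbert_cube" "x \<in> hilbert_cube"
  shows "squeeze z x \<in> hilbert_cube"
proof -
  have "0 \<le> (\<Prod>i\<le>j. z i)" "(\<Prod>i\<le>j. z i) \<le> 1" for j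
    using assms(1) by (auto simp: hilbert_cube_def intro!: prod_nonneg prod_le_1)
  then show ?thesis
    using assms(2) by (simp add: hilbert_cube_def squeeze_def mult_le_one)
qed

lemma Peano_set_image_compactum:
  assumes K: "connected K" "x \<in> K" "y \<in> K" "x \<noteq> y"
    and S: "Peano_set S" "S \<subseteq> hilbert_cube"
  shows "S \<in> image_compacta K"
proof -
  obtain h :: "'b \<Rightarrow> real" where h: "continuous_on K h" "h ` K = {0..1}"
    using connected_onto_unit_interval[OF K] by blast
  obtain p where p: "path p" "path_image p = S"
    using S(1) by (auto simp: Peano_set_def)
  have "continuous_on K (p \<circ> h)"
    using h p(1) by (intro continuous_on_compose) (auto simp: path_def)
  moreover have "(p \<circ> h) ` K = S"
    using h(2) p(2) by (simp only: image_comp[symmetric] path_image_def)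
  ultimately show ?thesis using S(2) unfolding image_compacta_def by blast
qed

text \<open>The rescaled total space is compact as a continuous image of a compact set. Over a code without
  zeros, rescaling is injective and the fibre is a copy of the image of the coded map. Over any other
  code the fibre is a curve, hence an image of the unit interval, and the nondegenerate continuum \<open>K\<close>
  maps onto that interval.\<close>
proposition image_compacta_compactifiable:
  assumes K: "connected K" "x \<in> K" "y \<in> K" "x \<noteq> y"
    and C: "top_of_set ` image_compacta K \<cong>\<^sub>C C"
  shows "compactifiable C"
proof (rule compactifiableI)
  define A where "A = (\<lambda>p. (fst p, squeeze (fst (fst p)) (snd p))) ` total_space"
  have fibre: "{x. ((z, u), x) \<in> A} = squeeze z ` {x. ((z, u), x) \<in> total_space}" for z u
    by (force simp: A_def)
  have "continuous_on total_space (\<lambda>p. (fst p, squeeze (fst (fst p)) (snd p)))"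
    unfolding squeeze_def
    by (intro continuous_on_Pair continuous_on_fst continuous_on_id continuous_on_mult continuous_on_prod
        continuous_on_coordinatewise_then_product continuous_on_subset[OF continuous_coordinates(5)]
        continuous_on_subset[OF continuous_coordinates(4)]) auto
  then have "compact A"
    unfolding A_def by (intro compact_continuous_image compact_total_space)
  then show "metrizable_compactum (top_of_set A)"
    by (rule metrizable_compactum_top_of_set)
  show "metrizable_compactum (top_of_set codes)"
    by (rule metrizable_compactum_top_of_set[OF compact_codes])
  have sub: "fst ` A \<subseteq> codes"
    by (auto simp: A_def total_space_def)
  then show "continuous_map (top_of_set A) (top_of_set codes) fst"
    by (auto intro!: continuous_intros)
  have "(\<lambda>b. top_of_set {x. (b, x) \<in> A}) ` codes \<cong>\<^sub>C top_of_set ` image_compacta K"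
    unfolding equivalent_classes_def
  proof (intro conjI ballI)
    fix X assume "X \<in> (\<lambda>b. top_of_set {x. (b, x) \<in> A}) ` codes"
    then obtain z u where zu: "(z, u) \<in> codes"
      and X: "X = top_of_set (squeeze z ` {x. ((z, u), x) \<in> total_space})"
      using fibre by auto
    show "\<exists>Y\<in>top_of_set ` image_compacta K. X homeomorphic_space Y"
    proof (cases "\<exists>n. z n = 0")
      case True
      then obtain n where "z n = 0" by blast
      from irregular_fibre[OF zu this K(1)] K(2)
      have "Peano_set (squeeze z ` {x. ((z, u), x) \<in> total_space})"
        using Peano_set_image continuous_on_squeeze by blast
      moreover have "squeeze z ` {x. ((z, u), x) \<in> total_space} \<subseteq> hilbert_cube"
        using squeeze_hilbert_cube code_cube(2)[OF zu] by (auto simp: total_space_def)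
      ultimately have "squeeze z ` {x. ((z, u), x) \<in> total_space} \<in> image_compacta K"
        by (rule Peano_set_image_compactum[OF K])
      then show ?thesis unfolding X using homeomorphic_space_refl by blast
    next
      case False
      then have pos: "0 < z k" for k
        using code_bounds[OF zu, of k] by (auto simp: order_less_le)
      have L: "closure (range u) \<in> image_compacta K"
        by (rule regular_fibre_image_compactum[OF zu pos])
      have "compact (closure (range u))"
        using code_decode[OF zu pos] compact_continuous_image compact_K by metis
      then have "top_of_set (closure (range u)) homeomorphic_space X"
        unfolding X regular_fibre[OF zu pos]
        using inj_on_subset[OF inj_squeeze[of z, OF pos]] continuous_on_squeeze
        by (intro homeomorphic_top_of_set_image) auto
      with L show ?thesis using homeomorphic_space_sym by blast
    qed
  next
    fix Y assume "Y \<in> top_of_set ` image_compacta K"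
    then obtain f where f: "continuous_on K f" "f ` K \<subseteq> hilbert_cube" "Y = top_of_set (f ` K)"
      by (auto simp: image_compacta_def)
    then obtain z where z: "(z, f \<circ> m) \<in> codes" "\<And>k. 0 < z k" "closure (range (f \<circ> m)) = f ` K"
      using code_exists by metis
    have "{x. ((z, f \<circ> m), x) \<in> A} = squeeze z ` f ` K"
      using fibre regular_fibre[OF z(1,2)] z(3) by simp
    moreover have "Y homeomorphic_space top_of_set (squeeze z ` f ` K)"
      unfolding f(3)
      using compact_continuous_image[OF f(1) compact_K] inj_on_subset[OF inj_squeeze[of z, OF z(2)]]
        continuous_on_squeeze
      by (intro homeomorphic_top_of_set_image) auto
    ultimately have "Y homeomorphic_space top_of_set {x. ((z, f \<circ> m), x) \<in> A}" by simp
    moreover have "top_of_set {x. ((z, f \<circ> m), x) \<in> A} \<in> (\<lambda>b. top_of_set {x. (b, x) \<in> A}) ` codes"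
      using z(1) by (rule imageI)
    ultimately show "\<exists>X\<in>(\<lambda>b. top_of_set {x. (b, x) \<in> A}) ` codes. Y homeomorphic_space X"
      by (rule bexI)
  qed
  from equivalent_classes_trans[OF equivalent_classes_trans[OF fibres_fst_equivalent[OF sub] this] C]
  show "fibres (top_of_set A) (top_of_set codes) fst \<cong>\<^sub>C C" .
qed

end

section \<open>Classes with a common model\<close>

text \<open>A space with at most one point has only homeomorphic copies of itself as images, so one fibre
  suffices. This covers the empty space, which contains no sequence, and the one-point space, which
  does not map onto the unit interval.\<close>
lemma degenerate_class:
  fixes M :: "'a topology"
  assumes M: "M \<in> C" "metrizable_compactum M" "\<And>X. X \<in> C \<Longrightarrow> maps_onto M X"
    and deg: "\<And>x y. x \<in> topspace M \<Longrightarrow> y \<in> topspace M \<Longrightarrow> x = y"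
  shows "fibres M (top_of_set {0::real}) (\<lambda>_. 0) \<cong>\<^sub>C C"
proof -
  have "M homeomorphic_space X" if X: "X \<in> C" for X
  proof -
    obtain f where f: "continuous_map M X f" "f ` topspace M = topspace X"
      using M(3)[OF X] by (auto simp: maps_onto_def)
    have inj: "inj_on f (topspace M)" using deg by (auto intro: inj_onI)
    have "open_map M X f"
      unfolding open_map_def
    proof (intro allI impI)
      fix U assume U: "openin M U"
      then have "U = {} \<or> U = topspace M"
        using deg openin_subset[OF U] by blast
      then show "openin X (f ` U)" using f(2) by auto
    qed
    then show ?thesis
      using f inj bijective_open_imp_homeomorphic_map homeomorphic_map_imp_homeomorphic_space by blast
  qed
  moreover have "fibres M (top_of_set {0::real}) (\<lambda>_. 0) = {M}"
    by (simp add: fibres_def)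
  ultimately show ?thesis
    using M(1) homeomorphic_space_sym unfolding equivalent_classes_def by fastforce
qed

lemma metrizable_compactum_imp_Polish:
  "metrizable_compactum X \<Longrightarrow> Polish_topology X"
  unfolding Polish_topology_def
  using metrizable_compactum_imp_separable
  by (auto simp: metrizable_compactum_def locally_compact_imp_completely_metrizable_space
      compact_imp_locally_compact_space)

theorem common_model_strongly_Polishable:
  assumes C: "\<And>X. X \<in> C \<Longrightarrow> metrizable_compactum X" "closed_under_continuous_images C"
    and M: "common_model C M"
  shows "strongly_Polishable C"
proof -
  have MC: "M \<in> C" "metrizable_compactum M" using M C(1) by (auto simp: common_model_def)
  show ?thesis
  proof (cases "topspace M = {}")
    case True
    have "fibres M (top_of_set {0::real}) (\<lambda>_. 0) \<cong>\<^sub>C C"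
      using MC M True by (intro degenerate_class) (auto simp: common_model_def)
    then show ?thesis
      using MC(2) True
      by (intro strongly_PolishableI[where A = M and B = "top_of_set {0::real}" and q = "\<lambda>_. 0"]
          metrizable_compactum_imp_Polish metrizable_compactum_top_of_set)
        (auto simp: closed_map_def open_map_def closedin_topspace_empty openin_topspace_empty)
  next
    case False
    obtain K :: "(nat \<Rightarrow> real) set" where K: "compact K" "M homeomorphic_space top_of_set K"
      using metrizable_compactum_hilbert_cube_copy[OF MC(2)] by metis
    then have "K \<noteq> {}" using False homeomorphic_empty_space by fastforce
    then obtain m \<tau> where "net_sequence K m \<tau>"
      using compact_net_sequence[OF K(1)] K(1) unfolding net_sequence_def by metis
    then show ?thesis
      using closed_class_equivalent_image_compacta[OF C M K(2,1)]
      by (rule net_sequence.image_compacta_strongly_Polishable)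
  qed
qed

lemma nondegenerate_continuum_hilbert_cube_copy:
  assumes X: "metrizable_continuum X" "x \<in> topspace X" "y \<in> topspace X" "x \<noteq> y"
  shows "\<exists>K\<subseteq>hilbert_cube. X homeomorphic_space top_of_set K \<and> compact K \<and> connected K \<and>
    (\<exists>x\<in>K. \<exists>y\<in>K. x \<noteq> y)"
proof -
  obtain K :: "(nat \<Rightarrow> real) set" where K: "K \<subseteq> hilbert_cube" "compact K" "X homeomorphic_space top_of_set K"
    using metrizable_compactum_hilbert_cube_copy X(1) by (auto simp: metrizable_continuum_def)
  obtain h where "homeomorphic_map X (top_of_set K) h"
    using K(3) by (auto simp: homeomorphic_space)
  then have h: "h ` topspace X = K" "inj_on h (topspace X)"
    by (auto simp: homeomorphic_eq_everything_map)
  then have "\<exists>x\<in>K. \<exists>y\<in>K. x \<noteq> y"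
    using X(2-4) by (metis imageI inj_onD)
  moreover have "connected K"
    using X(1) homeomorphic_connected_space[OF K(3)]
    by (simp add: metrizable_continuum_def connectedin_def flip: connectedin_iff_connected)
  ultimately show ?thesis using K by blast
qed

theorem common_model_compactifiable:
  assumes C: "\<And>X. X \<in> C \<Longrightarrow> metrizable_continuum X" "closed_under_continuous_images C"
    and M: "common_model C M"
  shows "compactifiable C"
proof -
  have MC: "M \<in> C" "metrizable_compactum M" "connected_space M"
    using M C(1) by (auto simp: common_model_def metrizable_continuum_def)
  show ?thesis
  proof (cases "\<exists>x\<in>topspace M. \<exists>y\<in>topspace M. x \<noteq> y")
    case False
    have "fibres M (top_of_set {0::real}) (\<lambda>_. 0) \<cong>\<^sub>C C"
      using MC M False by (intro degenerate_class) (auto simp: common_model_def)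
    then show ?thesis
      using MC(2)
      by (intro compactifiableI[where A = M and B = "top_of_set {0::real}" and q = "\<lambda>_. 0"]
          metrizable_compactum_top_of_set) auto
  next
    case True
    then obtain K :: "(nat \<Rightarrow> real) set" where K: "M homeomorphic_space top_of_set K" "compact K" "connected K"
      "\<exists>x\<in>K. \<exists>y\<in>K. x \<noteq> y"
      using nondegenerate_continuum_hilbert_cube_copy[OF C(1)[OF MC(1)]] by metis
    then obtain x y where xy: "x \<in> K" "y \<in> K" "x \<noteq> y" by blast
    obtain m \<tau> where net: "net_sequence K m \<tau>"
      using compact_net_sequence[OF K(2)] K(2) xy unfolding net_sequence_def by (metis empty_iff)
    have "metrizable_compactum X" if "X \<in> C" for X
      using C(1)[OF that] by (simp add: metrizable_continuum_def)
    then have "top_of_set ` image_compacta K \<cong>\<^sub>C C"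
      by (intro closed_class_equivalent_image_compacta[OF _ C(2) M K(1,2)])
    then show ?thesis
      by (rule net_sequence.image_compacta_compactifiable[OF net K(3) xy])
  qed
qed

lemma maps_onto_continuum:
  assumes "maps_onto X Y" "metrizable_continuum X" "metrizable_space Y"
  shows "metrizable_continuum Y"
proof -
  obtain f where f: "continuous_map X Y f" "f ` topspace X = topspace Y"
    using assms(1) by (auto simp: maps_onto_def)
  have "compactin X (topspace X)" "connectedin X (topspace X)"
    using assms(2) by (simp_all add: metrizable_continuum_def metrizable_compactum_def
        compact_space_def connectedin_topspace)
  then have "compactin Y (topspace Y)" "connectedin Y (topspace Y)"
    using image_compactin[OF _ f(1)] connectedin_continuous_map_image[OF f(1)] f(2) by metis+
  then show ?thesis
    using assms(3) by (simp add: metrizable_continuum_def metrizable_compactum_def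
        compact_space_def connectedin_topspace)
qed

lemma nondegenerate_continuum_lepoll:
  assumes X: "metrizable_continuum X" "x \<in> topspace X" "y \<in> topspace X" "x \<noteq> y"
  shows "(UNIV :: real set) \<lesssim> topspace X"
proof -
  obtain K :: "(nat \<Rightarrow> real) set" where K: "X homeomorphic_space top_of_set K" "connected K" "\<exists>x\<in>K. \<exists>y\<in>K. x \<noteq> y"
    using nondegenerate_continuum_hilbert_cube_copy[OF X] by metis
  obtain h :: "(nat \<Rightarrow> real) \<Rightarrow> real" where h: "h ` K = {0..1}"
    using K(2,3) connected_onto_unit_interval by metis
  obtain g where g: "g ` topspace X = K"
    using homeomorphic_imp_maps_onto[OF K(1)] by (auto simp: maps_onto_def)
  have "{0..1::real} \<lesssim> topspace X"
    using g h by (metis image_lepoll image_comp)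
  moreover have "(UNIV :: real set) \<lesssim> {0..1::real}"
  proof -
    have "inj (\<lambda>x. (arctan x + pi / 2) / pi)"
      by (auto simp: inj_on_def arctan_eq_iff)
    moreover have "(arctan x + pi / 2) / pi \<in> {0..1}" for x
      using arctan_lbound[of x] arctan_ubound[of x] by (auto simp: field_simps)
    ultimately show ?thesis unfolding lepoll_def by blast
  qed
  ultimately show ?thesis using lepoll_trans by blast
qed

text \<open>If the carrier type has room for a copy of \<open>P\<close>, this copy is a common model. Otherwise the
  type has fewer elements than the reals, so that all images of \<open>P\<close> in it are single points, and
  a one-point space is a common model.\<close>
theorem continuous_images_compactifiable:
  fixes P :: "'p topology"
  assumes P: "metrizable_continuum P" "topspace P \<noteq> {}"
  shows "compactifiable {X :: 'a topology. metrizable_space X \<and> maps_onto P X}"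
    (is "compactifiable ?C")
proof (rule common_model_compactifiable)
  show cont: "metrizable_continuum X" if "X \<in> ?C" for X
    using that P(1) maps_onto_continuum by blast
  show "closed_under_continuous_images ?C"
    unfolding closed_under_continuous_images_def metrizable_compactum_def
    using maps_onto_compose by blast
  define Z :: "'a topology" where "Z = (if topspace P \<lesssim> (UNIV :: 'a set)
    then SOME Z. P homeomorphic_space Z else discrete_topology {undefined})"
  show "common_model ?C Z"
  proof (cases "topspace P \<lesssim> (UNIV :: 'a set)")
    case True
    then have Z: "P homeomorphic_space Z"
      using someI_ex[OF lepoll_homeomorphic_copy[OF True]] by (simp add: Z_def)
    then have "metrizable_space Z"
      using P(1) homeomorphic_metrizable_space
      by (auto simp: metrizable_continuum_def metrizable_compactum_def)
    moreover have "maps_onto P Z" "maps_onto Z P"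
      using Z homeomorphic_space_sym[of P Z] by (auto intro: homeomorphic_imp_maps_onto)
    ultimately show ?thesis
      unfolding common_model_def using maps_onto_compose[of Z P] by auto
  next
    case False
    then have Z: "Z = discrete_topology {undefined}" by (simp add: Z_def)
    have real: "topspace P \<lesssim> (UNIV :: real set)"
    proof -
      obtain Y :: "real topology" where "P homeomorphic_space Y"
        using real_copy[of P] metrizable_compactum_imp_separable[of P] P(1)
        unfolding metrizable_continuum_def metrizable_compactum_def by metis
      then obtain g where "homeomorphic_map P Y g" by (auto simp: homeomorphic_space)
      then have "inj_on g (topspace P)" by (auto simp: homeomorphic_eq_everything_map)
      then show ?thesis unfolding lepoll_def by blast
    qed
    have deg: "x = y" if X: "X \<in> ?C" and xy: "x \<in> topspace X" "y \<in> topspace X" for X x y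
    proof (rule ccontr)
      assume "x \<noteq> y"
      then have "(UNIV :: real set) \<lesssim> topspace X"
        using nondegenerate_continuum_lepoll[OF cont[OF X] xy] by blast
      then have "(UNIV :: real set) \<lesssim> (UNIV :: 'a set)"
        using lepoll_trans subset_imp_lepoll subset_UNIV by blast
      then show False using real False lepoll_trans by blast
    qed
    have "maps_onto P Z"
      unfolding maps_onto_def Z using P(2)
      by (intro exI[of _ "\<lambda>_. undefined"] conjI) (simp, simp only: image_constant_conv if_False
          topspace_discrete_topology)
    moreover have "maps_onto Z X" if X: "X \<in> ?C" for X
    proof -
      obtain f where "f ` topspace P = topspace X" using X by (auto simp: maps_onto_def)
      then obtain a where a: "a \<in> topspace X" using P(2) by blast
      then have "topspace X = {a}" using deg[OF X] by blast
      then show ?thesis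
        unfolding maps_onto_def Z by (intro exI[of _ "\<lambda>_. a"]) auto
    qed
    ultimately show ?thesis
      unfolding common_model_def Z by (simp add: metrizable_space_discrete_topology)
  qed
qed

theorem corollary4p25:
  shows "(\<forall>C :: 'a topology set.
            (\<forall>X\<in>C. metrizable_compactum X) \<and> closed_under_continuous_images C \<and>
            (\<exists>M. common_model C M) \<longrightarrow> strongly_Polishable C) \<and>
         (\<forall>C :: 'a topology set.
            (\<forall>X\<in>C. metrizable_continuum X) \<and> closed_under_continuous_images C \<and>
            (\<exists>M. common_model C M) \<longrightarrow> compactifiable C) \<and>
         compactifiable (peano_continua :: 'a topology set) \<and>
         (\<forall>P :: 'p topology. pseudoarc P \<longrightarrow>
            compactifiable (weakly_chainable_continua P :: 'a topology set))"
proof (intro conjI allI impI)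
  show "strongly_Polishable C"
    if "(\<forall>X\<in>C. metrizable_compactum X) \<and> closed_under_continuous_images C \<and> (\<exists>M. common_model C M)"
    for C :: "'a topology set"
    using that common_model_strongly_Polishable by blast
  show "compactifiable C"
    if "(\<forall>X\<in>C. metrizable_continuum X) \<and> closed_under_continuous_images C \<and> (\<exists>M. common_model C M)"
    for C :: "'a topology set"
    using that common_model_compactifiable by blast
  have "metrizable_continuum (top_of_set {0..1::real})"
    by (simp add: metrizable_continuum_def metrizable_compactum_top_of_set connected_space_subtopology
        flip: connectedin_iff_connected)
  then show "compactifiable (peano_continua :: 'a topology set)"
    unfolding peano_continua_def by (rule continuous_images_compactifiable) simp
  show "compactifiable (weakly_chainable_continua P :: 'a topology set)" if "pseudoarc P" for P :: "'p topology"
    unfolding weakly_chainable_continua_def using that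
    by (intro continuous_images_compactifiable) (auto simp: pseudoarc_def)
qed

end
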